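(* Let $G$ be a connected, simply connected simple algebraic group over $\mathbb{C}$ with maximal torus $A$, Borel subgroup $B\supseteq A$, Weyl group $W$, root system $R$, center $Z$. Fix an embedding of groups $\iota:\mathbb{Q}/\mathbb{Z}\hookrightarrow\mathbb{C}^\times$ and, for $x\in Z$, let $\mu_x\in P(R^\vee)/Q(R^\vee)$ correspond to $x$ under the induced isomorphism $Z\cong P(R^\vee)/Q(R^\vee)$. Then: (a) For every $x\in Z$ there exist $g\in W$ and a regular element $u\in A$ with $g(u)=xu$; moreover one can take $g=\psi(\mu_x)$. (b) For fixed $x\in Z$, the element $g\in W$ for which some regular $u\in A$ satisfies $g(u)=xu$ is uniquely determined up to conjugation in $W$. (c) The eigenvalues, with multiplicities, of such an element $g$ acting on $\mathrm{Lie}(A)$ are precisely the complex numbers $\varpi_i(x)^{-1}$, $i\in I$.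
   Context: $\{\alpha_i\}_{i\in I}$ are the simple roots determined by $B$ and $\varpi_i$ the fundamental weights; $X^*(A)=P(R)$ and $X_*(A)=Q(R^\vee)$. An element $u\in A$ is regular if $\alpha(u)\ne1$ for all $\alpha\in R$ (equivalently its $W$-stabilizer is trivial). The isomorphism $P(R^\vee)/Q(R^\vee)\cong Z$ induced by $\iota$ sends the class of $\mu\in P(R^\vee)$ to the element $x_\mu\in A$ with $\lambda(x_\mu)=\iota(\langle\lambda,\mu\rangle\bmod\mathbb{Z})$ for all $\lambda\in P(R)$. $\psi$: the extended affine Weyl group $W_e=P(R^\vee)\rtimes W$ acts on $V^*$ ($V=Q(R)\otimes\mathbb{R}$), $P(R^\vee)$ by translations and $W$ linearly; with $\tilde\alpha$ the highest root, $C=\{v:\langle\alpha_i,v\rangle>0\ \forall i,\ \langle\tilde\alpha,v\rangle<1\}$ is the fundamental alcove; since $W_a=Q(R^\vee)\rtimes W$ acts simply transitively on alcoves, the stabilizer $\Gamma_C$ of $C$ in $W_e$ maps isomorphically ($\xi$) onto $W_e/W_a\cong P(R^\vee)/Q(R^\vee)$, and $\psi=\mathrm{pr}\circ\xi^{-1}$ with $\mathrm{pr}:W_e\to W$ the projection. *)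

theory Defs
  imports "HOL-Analysis.Analysis" "HOL-Computational_Algebra.Polynomial"
begin

text \<open>Everything is expressed through the (reduced, irreducible) root system R of G in
V = real^'n (V identified with its dual via a W-invariant inner product).
Since G is simply connected, X^*(A) = P(R), so the torus A is Hom(P(R), C^*).\<close>

definition coroot :: "real^'n \<Rightarrow> real^'n" where
  "coroot a = (2 / (a \<bullet> a)) *\<^sub>R a"

definition refl :: "real^'n \<Rightarrow> real^'n \<Rightarrow> real^'n" where
  "refl a v = v - (v \<bullet> coroot a) *\<^sub>R a"

definition root_system :: "(real^'n) set \<Rightarrow> bool" where
  "root_system R \<longleftrightarrow> finite R \<and> 0 \<notin> R \<and> span R = UNIV
     \<and> (\<forall>a\<in>R. refl a ` R = R)
     \<and> (\<forall>a\<in>R. \<forall>b\<in>R. b \<bullet> coroot a \<in> \<int>)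
     \<and> (\<forall>a\<in>R. \<forall>c. c *\<^sub>R a \<in> R \<longrightarrow> c = 1 \<or> c = -1)
     \<and> \<not> (\<exists>R1 R2. R1 \<noteq> {} \<and> R2 \<noteq> {} \<and> R1 \<union> R2 = R \<and> (\<forall>a\<in>R1. \<forall>b\<in>R2. a \<bullet> b = 0))"

definition int_span :: "(real^'n) set \<Rightarrow> (real^'n) set" where
  "int_span S = {\<Sum>a\<in>S. real_of_int (c a) *\<^sub>R a | c. True}"

definition nonneg_int_span :: "(real^'n) set \<Rightarrow> (real^'n) set" where
  "nonneg_int_span S = {\<Sum>a\<in>S. real_of_int (c a) *\<^sub>R a | c. \<forall>a\<in>S. c a \<ge> 0}"

definition is_base :: "(real^'n) set \<Rightarrow> (real^'n) set \<Rightarrow> bool" where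
  "is_base R D \<longleftrightarrow> D \<subseteq> R \<and> independent D \<and>
     (\<forall>b\<in>R. \<exists>c :: real^'n \<Rightarrow> int. b = (\<Sum>a\<in>D. real_of_int (c a) *\<^sub>R a)
         \<and> ((\<forall>a\<in>D. c a \<ge> 0) \<or> (\<forall>a\<in>D. c a \<le> 0)))"

inductive_set weyl_group :: "(real^'n) set \<Rightarrow> (real^'n \<Rightarrow> real^'n) set" for R where
  weyl_id: "id \<in> weyl_group R"
| weyl_refl: "a \<in> R \<Longrightarrow> w \<in> weyl_group R \<Longrightarrow> refl a \<circ> w \<in> weyl_group R"

definition wlat :: "(real^'n) set \<Rightarrow> (real^'n) set" where
  "wlat R = {l. \<forall>a\<in>R. l \<bullet> coroot a \<in> \<int>}"

definition cowlat :: "(real^'n) set \<Rightarrow> (real^'n) set" where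
  "cowlat R = {v. \<forall>a\<in>R. a \<bullet> v \<in> \<int>}"

definition corootlat :: "(real^'n) set \<Rightarrow> (real^'n) set" where
  "corootlat R = int_span (coroot ` R)"

definition highest_root :: "(real^'n) set \<Rightarrow> (real^'n) set \<Rightarrow> real^'n" where
  "highest_root R D = (THE t. t \<in> R \<and> (\<forall>b\<in>R. t - b \<in> nonneg_int_span D))"

definition alcove :: "(real^'n) set \<Rightarrow> (real^'n) set \<Rightarrow> (real^'n) set" where
  "alcove R D = {v. (\<forall>a\<in>D. a \<bullet> v > 0) \<and> highest_root R D \<bullet> v < 1}"

text \<open>psi(mu): the linear part of the unique element v |-> nu + w v of the extended
affine Weyl group stabilising the fundamental alcove with nu = mu mod Q(R^v).\<close>
definition psi :: "(real^'n) set \<Rightarrow> (real^'n) set \<Rightarrow> real^'n \<Rightarrow> (real^'n \<Rightarrow> real^'n)" where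
  "psi R D mu = (THE w. w \<in> weyl_group R \<and>
      (\<exists>nu\<in>cowlat R. nu - mu \<in> corootlat R \<and> (\<lambda>v. nu + w v) ` alcove R D = alcove R D))"

text \<open>The maximal torus A = Hom(P(R), C^*), elements as functions on V (only values on
P(R) matter).\<close>
definition torus :: "(real^'n) set \<Rightarrow> (real^'n \<Rightarrow> complex) set" where
  "torus R = {u. (\<forall>l\<in>wlat R. u l \<noteq> 0) \<and>
                 (\<forall>l\<in>wlat R. \<forall>l'\<in>wlat R. u (l + l') = u l * u l')}"

definition center :: "(real^'n) set \<Rightarrow> (real^'n \<Rightarrow> complex) set" where
  "center R = {x \<in> torus R. \<forall>a\<in>R. x a = 1}"

definition regular :: "(real^'n) set \<Rightarrow> (real^'n \<Rightarrow> complex) \<Rightarrow> bool" where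
  "regular R u \<longleftrightarrow> (\<forall>a\<in>R. u a \<noteq> 1)"

text \<open>g(u) = x u in A, where (g u)(l) = u(g^{-1} l).\<close>
definition twisted_fix :: "(real^'n) set \<Rightarrow> (real^'n \<Rightarrow> real^'n) \<Rightarrow> (real^'n \<Rightarrow> complex)
    \<Rightarrow> (real^'n \<Rightarrow> complex) \<Rightarrow> bool" where
  "twisted_fix R g x u \<longleftrightarrow> (\<forall>l\<in>wlat R. u (inv g l) = x l * u l)"

definition torus_eq :: "(real^'n) set \<Rightarrow> (real^'n \<Rightarrow> complex) \<Rightarrow> (real^'n \<Rightarrow> complex) \<Rightarrow> bool" where
  "torus_eq R x y \<longleftrightarrow> (\<forall>l\<in>wlat R. x l = y l)"

text \<open>An embedding iota : Q/Z -> C^*, as a homomorphism Q -> C^* with kernel Z.\<close>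
definition QZ_embedding :: "(rat \<Rightarrow> complex) \<Rightarrow> bool" where
  "QZ_embedding iota \<longleftrightarrow> (\<forall>a b. iota (a + b) = iota a * iota b) \<and> (\<forall>a. iota a = 1 \<longleftrightarrow> a \<in> \<int>)"

definition xmu :: "(rat \<Rightarrow> complex) \<Rightarrow> real^'n \<Rightarrow> (real^'n \<Rightarrow> complex)" where
  "xmu iota mu = (\<lambda>l. iota (THE q. real_of_rat q = l \<bullet> mu))"

definition fund_weight :: "(real^'n) set \<Rightarrow> real^'n \<Rightarrow> real^'n" where
  "fund_weight D a = (THE l. \<forall>b\<in>D. l \<bullet> coroot b = (if b = a then 1 else 0))"

text \<open>Characteristic polynomial (over C) of a linear map of V, i.e. of its
complexification acting on Lie(A) = V (x) C.\<close>
definition charpoly :: "(real^'n \<Rightarrow> real^'n) \<Rightarrow> complex poly" where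
  "charpoly g = det (\<chi> i j. (if i = j then [:0, 1:] else 0) - [:complex_of_real (matrix g $ i $ j):])"

end

theory Submission
  imports Defs
begin

text \<open>View the elements of A as characters of P(R). An element v |-> nu + w v of the extended affine Weyl group that
  preserves the alcove C fixes the point p = rho/h of C, and then w multiplies exp(-p) by exp(nu);
  this gives (a). Conversely, if g(u) = xu with u regular, one perturbs u to a regular compact
  element exp(t) without changing g and moves t into C by the affine Weyl group; a conjugate of g
  then is the linear part of an element preserving C whose translation part lies in a fixed coset
  of the coroot lattice, and such an element is unique because the affine Weyl group acts freely
  on alcoves. This is (b).

  For (c), the vector F_i, the sum of u(l)^(-1) l over the W-orbit of the fundamental weight
  varpi_i, is an eigenvector of g for varpi_i(x)^(-1). The F_i are the gradients at u^(-1) of the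
  orbit sums of the fundamental weights. If a linear form L kills all of them, it kills the
  gradients of all W-invariant functions, as these are generated by the fundamental orbit sums.
  The characters w u^(-1), for w in W, are distinct because u is regular, so Dedekind independence
  with linear coefficients forces L = 0. Hence the F_i form an eigenbasis.\<close>

subsection \<open>Reflections and lattices\<close>

text \<open>The embedding \<open>iota\<close> is arbitrary: it lives on the rationals and has no
  continuity to exploit. Hence (a) calls for a solution u with rational exponents, which is why a
  fixed point of the alcove with rational coordinates is constructed; averaging over W shows that
  weights and coweights pair rationally.

  Free and transitive action of the affine Weyl group is obtained combinatorially, without the
  topology of the alcoves: C is described by signs of affine roots, the sign of an affine root can
  be read off from its coefficients in the walls, and words in wall reflections are shortened by an
  exchange argument.

  In (c) eigenvectors are easy to write down, but different fundamental weights may give the same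
  eigenvalue (for x = 1 all of them do), so the multiplicities rest entirely on the linear
  independence of the F_i. This is the nonvanishing of the Jacobian of the fundamental orbit sums at
  a regular element; it is reached without evaluating that determinant.\<close>

lemma inner_coroot: "v \<bullet> coroot a = 2 * (v \<bullet> a) / (a \<bullet> a)"
  by (simp add: coroot_def)

lemma linear_refl: "linear (refl a)"
  unfolding refl_def by (auto intro!: linearI simp: inner_add_left algebra_simps)

lemma refl_refl [simp]: "refl a (refl a v) = v"
  by (cases "a = 0") (simp_all add: refl_def inner_coroot algebra_simps)

lemma refl_inner: "refl a v \<bullet> refl a w = v \<bullet> w"
proof (cases "a = 0")
  case False
  then show ?thesis
    by (simp add: refl_def inner_coroot inner_diff_left inner_diff_right inner_commute)
qed (simp add: refl_def)

lemma refl_self: "a \<noteq> 0 \<Longrightarrow> refl a a = - a"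
  by (simp add: refl_def inner_coroot scaleR_2)

lemma coroot_self: "a \<noteq> 0 \<Longrightarrow> a \<bullet> coroot a = 2"
  by (simp add: inner_coroot)

lemma coroot_minus: "coroot (- a) = - coroot a"
  by (simp add: coroot_def)

lemma orthogonal_transformation_refl: "orthogonal_transformation (refl a)"
  by (simp add: orthogonal_transformation_def linear_refl refl_inner)

lemma coroot_orthogonal:
  assumes "orthogonal_transformation g"
  shows "coroot (g a) = g (coroot a)"
  using assms unfolding coroot_def orthogonal_transformation_def
  by (simp add: linear_scale)

lemma weyl_orthogonal: "w \<in> weyl_group R \<Longrightarrow> orthogonal_transformation w"
proof (induction rule: weyl_group.induct)
  case weyl_id
  show ?case by (simp add: id_def)
next
  case (weyl_refl a w)
  then show ?case
    by (intro orthogonal_transformation_compose orthogonal_transformation_refl)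
qed

lemma weyl_linear: "w \<in> weyl_group R \<Longrightarrow> linear w"
  using orthogonal_transformation_linear weyl_orthogonal by blast

lemma weyl_inner: "w \<in> weyl_group R \<Longrightarrow> w x \<bullet> w y = x \<bullet> y"
  using weyl_orthogonal orthogonal_transformation_def by blast

lemma weyl_bij: "w \<in> weyl_group R \<Longrightarrow> bij w"
  using orthogonal_transformation_bij weyl_orthogonal by blast

lemma weyl_comp: "v \<in> weyl_group R \<Longrightarrow> w \<in> weyl_group R \<Longrightarrow> v \<circ> w \<in> weyl_group R"
  by (induction rule: weyl_group.induct) (auto simp: comp_assoc intro: weyl_group.intros)

lemma refl_in_weyl: "a \<in> R \<Longrightarrow> refl a \<in> weyl_group R"
  using weyl_group.weyl_refl[OF _ weyl_group.weyl_id, of a R] by simp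

lemma weyl_inv: "w \<in> weyl_group R \<Longrightarrow> inv w \<in> weyl_group R"
proof (induction rule: weyl_group.induct)
  case (weyl_refl a w)
  have b: "bij (refl a)"
    by (rule o_bij[where g = "refl a"]) (simp_all add: fun_eq_iff)
  have i: "inv (refl a) = refl a"
    by (rule inv_equality) simp_all
  have "inv (refl a \<circ> w) = inv w \<circ> refl a"
    using o_inv_distrib[OF b weyl_bij] weyl_refl i by metis
  then show ?case
    using weyl_comp weyl_refl refl_in_weyl by metis
qed (use weyl_group.weyl_id in \<open>simp only: inv_id\<close>)

lemma weyl_inv_left [simp]: "w \<in> weyl_group R \<Longrightarrow> inv w (w x) = x"
  by (simp add: weyl_bij bij_is_inj)

lemma weyl_inv_right [simp]: "w \<in> weyl_group R \<Longrightarrow> w (inv w x) = x"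
  by (simp add: weyl_bij bij_is_surj surj_f_inv_f)

lemma weyl_inner_inv: "w \<in> weyl_group R \<Longrightarrow> inv w x \<bullet> y = x \<bullet> w y"
  by (metis weyl_inner weyl_inv_right)

lemmas weyl_add = linear_add[OF weyl_linear]
lemmas weyl_diff = linear_diff[OF weyl_linear]
lemmas weyl_scale = linear_scale[OF weyl_linear]
lemmas weyl_zero = linear_0[OF weyl_linear]

lemma bij_betw_weyl_left:
  assumes "v \<in> weyl_group R"
  shows "bij_betw (\<lambda>w. v \<circ> w) (weyl_group R) (weyl_group R)"
  by (rule bij_betwI[where g = "\<lambda>w. inv v \<circ> w"])
     (use assms in \<open>auto simp: weyl_comp weyl_inv fun_eq_iff\<close>)

lemma bij_betw_weyl_right:
  assumes "v \<in> weyl_group R"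
  shows "bij_betw (\<lambda>w. w \<circ> v) (weyl_group R) (weyl_group R)"
  by (rule bij_betwI[where g = "\<lambda>w. w \<circ> inv v"])
     (use assms in \<open>auto simp: weyl_comp weyl_inv fun_eq_iff\<close>)

section \<open>Based root systems and their Weyl groups\<close>

locale based_root_system =
  fixes R D :: "(real^'n) set"
  assumes rs: "root_system R" and base: "is_base R D"
begin

abbreviation "W \<equiv> weyl_group R"

lemma finite_R [simp]: "finite R" and span_R: "span R = UNIV"
  and root_nonzero: "a \<in> R \<Longrightarrow> a \<noteq> 0"
  and refl_root: "a \<in> R \<Longrightarrow> b \<in> R \<Longrightarrow> refl a b \<in> R"
  and coroot_int: "a \<in> R \<Longrightarrow> b \<in> R \<Longrightarrow> b \<bullet> coroot a \<in> \<int>"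
  and reduced: "a \<in> R \<Longrightarrow> c *\<^sub>R a \<in> R \<Longrightarrow> c = 1 \<or> c = -1"
proof -
  note * = rs[unfolded root_system_def]
  show "finite R" "span R = UNIV" using * by simp_all
  show "a \<in> R \<Longrightarrow> a \<noteq> 0" using * by metis
  show "a \<in> R \<Longrightarrow> b \<in> R \<Longrightarrow> refl a b \<in> R" using * by (metis imageI)
  show "a \<in> R \<Longrightarrow> b \<in> R \<Longrightarrow> b \<bullet> coroot a \<in> \<int>" using * by metis
  show "a \<in> R \<Longrightarrow> c *\<^sub>R a \<in> R \<Longrightarrow> c = 1 \<or> c = -1" using * by metis
qed

lemma irreducible:
  assumes "R = R1 \<union> R2" "\<And>a b. a \<in> R1 \<Longrightarrow> b \<in> R2 \<Longrightarrow> a \<bullet> b = 0"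
  shows "R1 = {} \<or> R2 = {}"
proof (rule ccontr)
  assume "\<not> ?thesis"
  then have "\<exists>R1 R2. R1 \<noteq> {} \<and> R2 \<noteq> {} \<and> R1 \<union> R2 = R \<and> (\<forall>a\<in>R1. \<forall>b\<in>R2. a \<bullet> b = 0)"
    using assms by metis
  then show False using rs[unfolded root_system_def] by simp
qed

lemma minus_root [simp]: "- a \<in> R \<longleftrightarrow> a \<in> R"
  using refl_root refl_self root_nonzero by (metis minus_minus)

lemma weyl_root: "w \<in> W \<Longrightarrow> a \<in> R \<Longrightarrow> w a \<in> R"
  by (induction rule: weyl_group.induct) (auto simp: refl_root)

lemma coroot_inner_pos_iff: "a \<in> R \<Longrightarrow> v \<bullet> coroot a > 0 \<longleftrightarrow> v \<bullet> a > 0"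
  
  by (drule root_nonzero)
     (use inner_ge_zero[of a] in \<open>auto simp: inner_coroot zero_less_divide_iff not_less simp del: inner_ge_zero\<close>)

lemma eq_zero_if_orthogonal_roots:
  assumes "\<And>a. a \<in> R \<Longrightarrow> a \<bullet> v = 0"
  shows "v = 0"
proof -
  have "x \<bullet> v = 0" if "x \<in> span R" for x
    using that by (induction rule: span_induct_alt) (auto simp: assms inner_add_left)
  from this[of v] show ?thesis by (simp add: span_R)
qed

text \<open>As the roots span, an element of W is determined by its restriction to the finite set R,
  which it maps into itself.\<close>

lemma finite_W [simp]: "finite W"
proof (rule inj_on_finite)
  show "inj_on (\<lambda>w. restrict w R) W"
  proof (rule inj_onI, rule ext)
    fix w w' v assume w: "w \<in> W" "w' \<in> W" and e: "restrict w R = restrict w' R"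
    have "v \<in> span R" by (simp add: span_R)
    moreover have "w a = w' a" if "a \<in> R" for a
      using e that by (metis restrict_apply')
    ultimately show "w v = w' v"
      using linear_eq_on_span[of w w' R v] w weyl_linear by blast
  qed
  show "(\<lambda>w. restrict w R) ` W \<subseteq> (\<Pi>\<^sub>E a\<in>R. R)"
    using weyl_root by auto
qed (simp add: finite_PiE)

lemma id_W [simp]: "id \<in> W"
  by (rule weyl_group.weyl_id)

lemma card_W_pos: "card W > 0"
  using card_gt_0_iff finite_W id_W by blast

lemma coroot_weyl: "w \<in> W \<Longrightarrow> coroot (w a) = w (coroot a)"
  using coroot_orthogonal weyl_orthogonal by blast

text \<open>The sum is fixed by every reflection, hence orthogonal to every root.\<close>

lemma sum_weyl_zero: "(\<Sum>w\<in>W. w l) = 0"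
proof (rule eq_zero_if_orthogonal_roots)
  fix a assume a: "a \<in> R"
  let ?s = "\<Sum>w\<in>W. w l"
  have "refl a ?s = (\<Sum>w\<in>W. (refl a \<circ> w) l)"
    by (simp add: linear_sum[OF linear_refl])
  also have "\<dots> = ?s"
    using sum.reindex_bij_betw[OF bij_betw_weyl_left[OF refl_in_weyl[OF a]], of "\<lambda>w. w l"] by simp
  finally have "(?s \<bullet> coroot a) *\<^sub>R a = 0" by (simp add: refl_def)
  then have "?s \<bullet> coroot a = 0"
    using root_nonzero[OF a] by simp
  then show "a \<bullet> ?s = 0"
    using root_nonzero[OF a] by (simp add: inner_coroot inner_commute[of _ ?s])
qed

section \<open>The weight, coweight and coroot lattices\<close>

lemma wlat_add: "l \<in> wlat R \<Longrightarrow> m \<in> wlat R \<Longrightarrow> l + m \<in> wlat R"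
  and wlat_minus: "l \<in> wlat R \<Longrightarrow> - l \<in> wlat R"
  and wlat_zero: "0 \<in> wlat R"
  and wlat_root: "a \<in> R \<Longrightarrow> a \<in> wlat R"
  unfolding wlat_def by (auto simp: inner_add_left coroot_int)

lemma wlat_diff: "l \<in> wlat R \<Longrightarrow> m \<in> wlat R \<Longrightarrow> l - m \<in> wlat R"
  using wlat_add[of l "- m"] wlat_minus by simp

lemma wlat_int: "l \<in> wlat R \<Longrightarrow> a \<in> R \<Longrightarrow> l \<bullet> coroot a \<in> \<int>"
  by (simp add: wlat_def)

lemma wlat_weyl:
  assumes w: "w \<in> W" and l: "l \<in> wlat R"
  shows "w l \<in> wlat R"
proof -
  have "w l \<bullet> coroot a = l \<bullet> coroot (inv w a)" if "a \<in> R" for a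
    using weyl_inner_inv[OF w, of "coroot a" l] coroot_weyl[OF weyl_inv[OF w], of a]
    by (simp add: inner_commute)
  then show ?thesis
    using wlat_int[OF l] weyl_root[OF weyl_inv[OF w]] by (simp add: wlat_def)
qed

lemma cowlat_add: "l \<in> cowlat R \<Longrightarrow> m \<in> cowlat R \<Longrightarrow> l + m \<in> cowlat R"
  and cowlat_minus: "l \<in> cowlat R \<Longrightarrow> - l \<in> cowlat R"
  and cowlat_zero: "0 \<in> cowlat R"
  and cowlat_coroot: "a \<in> R \<Longrightarrow> coroot a \<in> cowlat R"
  unfolding cowlat_def by (auto simp: inner_add_right coroot_int)

lemma cowlat_int: "v \<in> cowlat R \<Longrightarrow> a \<in> R \<Longrightarrow> a \<bullet> v \<in> \<int>"
  by (simp add: cowlat_def)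

lemma cowlat_weyl:
  assumes w: "w \<in> W" and v: "v \<in> cowlat R"
  shows "w v \<in> cowlat R"
  unfolding cowlat_def
  using cowlat_int[OF v] weyl_root[OF weyl_inv[OF w]] weyl_inner_inv[OF w, of _ v]
  by (auto simp del: weyl_inv_left weyl_inv_right) metis

lemma finite_coroots [simp]: "finite (coroot ` R)"
  by simp

lemma corootlat_zero: "0 \<in> corootlat R"
  unfolding corootlat_def int_span_def by (auto intro!: exI[of _ "\<lambda>_. 0"])

lemma corootlat_add:
  assumes "p \<in> corootlat R" "q \<in> corootlat R"
  shows "p + q \<in> corootlat R"
proof -
  obtain c d :: "real^'n \<Rightarrow> int"
    where "p = (\<Sum>a\<in>coroot ` R. of_int (c a) *\<^sub>R a)" "q = (\<Sum>a\<in>coroot ` R. of_int (d a) *\<^sub>R a)"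
    using assms unfolding corootlat_def int_span_def by blast
  then have "p + q = (\<Sum>a\<in>coroot ` R. of_int (c a + d a) *\<^sub>R a)"
    by (simp add: sum.distrib algebra_simps)
  then show ?thesis
    unfolding corootlat_def int_span_def by (auto intro!: exI[of _ "\<lambda>a. c a + d a"])
qed

lemma corootlat_scale:
  assumes "p \<in> corootlat R"
  shows "of_int m *\<^sub>R p \<in> corootlat R"
proof -
  obtain c :: "real^'n \<Rightarrow> int" where "p = (\<Sum>a\<in>coroot ` R. of_int (c a) *\<^sub>R a)"
    using assms unfolding corootlat_def int_span_def by blast
  then have "of_int m *\<^sub>R p = (\<Sum>a\<in>coroot ` R. of_int (m * c a) *\<^sub>R a)"
    by (simp add: scaleR_sum_right)
  then show ?thesis
    unfolding corootlat_def int_span_def by (auto intro!: exI[of _ "\<lambda>a. m * c a"])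
qed

lemma corootlat_minus: "p \<in> corootlat R \<Longrightarrow> - p \<in> corootlat R"
  using corootlat_scale[of p "-1"] by simp

lemma corootlat_diff: "p \<in> corootlat R \<Longrightarrow> q \<in> corootlat R \<Longrightarrow> p - q \<in> corootlat R"
  using corootlat_add[of p "- q"] corootlat_minus by simp

lemma corootlat_coroot:
  assumes "a \<in> R"
  shows "coroot a \<in> corootlat R"
proof -
  have "coroot a = (\<Sum>b\<in>coroot ` R. if b = coroot a then b else 0)"
    using assms by (subst sum.delta) auto
  also have "\<dots> = (\<Sum>b\<in>coroot ` R. of_int (if b = coroot a then 1 else 0) *\<^sub>R b)"
    by (rule sum.cong) auto
  finally show ?thesis
    unfolding corootlat_def int_span_def by (auto intro!: exI[of _ "\<lambda>b. if b = coroot a then 1 else 0"])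
qed

lemma corootlat_sum: "(\<And>i. i \<in> S \<Longrightarrow> f i \<in> corootlat R) \<Longrightarrow> sum f S \<in> corootlat R"
  by (induction S rule: infinite_finite_induct) (auto simp: corootlat_zero corootlat_add)

text \<open>Adding single coroots suffices because R is closed under negation: subtracting
  \<open>coroot a\<close> is adding \<open>coroot (- a)\<close>.\<close>

lemma corootlat_induct [consumes 1, case_names zero step]:
  assumes "q \<in> corootlat R" "P 0"
    and step: "\<And>a q. a \<in> R \<Longrightarrow> P q \<Longrightarrow> P (coroot a + q)"
  shows "P q"
proof -
  obtain c where q: "q = (\<Sum>a\<in>coroot ` R. of_int (c a) *\<^sub>R a)"
    using assms unfolding corootlat_def int_span_def by blast
  have nat_step: "P (real n *\<^sub>R coroot a + q)" if "a \<in> R" "P q" for n a q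
  proof (induction n)
    case (Suc n)
    then show ?case using step[OF that(1) Suc] by (simp add: algebra_simps)
  qed (use that in simp)
  have int_step: "P (of_int m *\<^sub>R coroot a + q)" if "a \<in> R" "P q" for m a q
  proof (cases "m \<ge> 0")
    case True
    then show ?thesis using nat_step[OF that, of "nat m"] by simp
  next
    case False
    then show ?thesis using nat_step[of "- a", OF _ that(2), of "nat (- m)"] that
      by (simp add: coroot_minus)
  qed
  have "P (\<Sum>a\<in>S. of_int (c a) *\<^sub>R a)" if "S \<subseteq> coroot ` R" for S
    using finite_subset[OF that finite_coroots] that
    by (induction S rule: finite_induct) (use assms int_step in auto)
  then show ?thesis using q by blast
qed

lemma corootlat_cowlat: "q \<in> corootlat R \<Longrightarrow> q \<in> cowlat R"
  by (induction rule: corootlat_induct) (auto simp: cowlat_zero cowlat_add cowlat_coroot)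

lemma corootlat_wlat_int: "q \<in> corootlat R \<Longrightarrow> l \<in> wlat R \<Longrightarrow> l \<bullet> q \<in> \<int>"
  by (induction rule: corootlat_induct) (auto simp: inner_add_right wlat_int)

lemma corootlat_weyl: "q \<in> corootlat R \<Longrightarrow> w \<in> W \<Longrightarrow> w q \<in> corootlat R"
  by (induction rule: corootlat_induct)
     (auto simp: weyl_zero weyl_add corootlat_zero weyl_root corootlat_add corootlat_coroot
           simp flip: coroot_weyl)

text \<open>W acts trivially on coweights modulo coroots, since \<open>refl a\<close> moves a
  coweight by an integer multiple of \<open>coroot a\<close>. For this reason conjugation preserves
  the coset of a translation part, and central elements of the torus are W-invariant.\<close>

lemma weyl_diff_corootlat: "w \<in> W \<Longrightarrow> v \<in> cowlat R \<Longrightarrow> w v - v \<in> corootlat R"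
proof (induction rule: weyl_group.induct)
  case (weyl_refl a w)
  let ?v = "w v"
  have "?v \<in> cowlat R" using weyl_refl cowlat_weyl by blast
  then obtain m where m: "a \<bullet> ?v = of_int m"
    using cowlat_int weyl_refl Ints_cases by metis
  have "(?v \<bullet> coroot a) *\<^sub>R a = of_int m *\<^sub>R coroot a"
    using m by (simp add: inner_coroot coroot_def inner_commute)
  then have "refl a ?v - v = (?v - v) - of_int m *\<^sub>R coroot a"
    by (simp add: refl_def)
  also have "\<dots> \<in> corootlat R" using weyl_refl
    by (intro corootlat_diff[OF _ corootlat_scale[OF corootlat_coroot]]) auto
  finally show ?case by simp
qed (simp add: corootlat_zero)

text \<open>Averaging over W: the elements of W move l only inside the root lattice, while the
  sum of the W-orbit of l vanishes.\<close>

lemma card_weyl_inner_int: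
  assumes l: "l \<in> wlat R" and v: "v \<in> cowlat R"
  shows "real (card W) * (l \<bullet> v) \<in> \<int>"
proof -
  have "(\<Sum>w\<in>W. l \<bullet> (w v - v)) \<in> \<int>"
    by (intro Ints_sum corootlat_wlat_int weyl_diff_corootlat assms)
  also have "(\<Sum>w\<in>W. l \<bullet> (w v - v)) = - (real (card W) * (l \<bullet> v))"
    using sum_weyl_zero[of v] by (simp add: inner_diff_right sum_subtractf flip: inner_sum_right)
  finally show ?thesis by simp
qed

text \<open>Makes the pairing a legitimate argument of \<open>iota\<close>, as the description in
  \<open>xmu\<close> requires.\<close>

lemma inner_wlat_cowlat_rat:
  assumes "l \<in> wlat R" "v \<in> cowlat R"
  shows "l \<bullet> v \<in> \<rat>"
proof -
  have "real (card W) * (l \<bullet> v) / real (card W) \<in> \<rat>"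
    using card_weyl_inner_int[OF assms] Ints_subset_Rats by (intro Rats_divide) auto
  moreover have "real (card W) \<noteq> 0" using card_W_pos by linarith
  ultimately show ?thesis by (metis nonzero_mult_div_cancel_left)
qed

end

subsection \<open>Simple roots and the highest root\<close>

lemma inner_coroot_scale: "(v \<bullet> coroot a) *\<^sub>R a = (a \<bullet> v) *\<^sub>R coroot a"
  by (simp add: coroot_def inner_commute)

lemma refl_coroot_form: "refl a v = v - (a \<bullet> v) *\<^sub>R coroot a"
  by (simp add: refl_def inner_coroot_scale)

lemma Ints_pos_ge_one: "(x::real) \<in> \<int> \<Longrightarrow> x > 0 \<Longrightarrow> x \<ge> 1"
  by (elim Ints_cases) simp

lemma of_int_floor_Ints: "(x::real) \<in> \<int> \<Longrightarrow> of_int \<lfloor>x\<rfloor> = x"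
  by (elim Ints_cases) simp

lemma finite_maximizer:
  fixes f :: "'a \<Rightarrow> real"
  assumes "finite S" "S \<noteq> {}"
  obtains t where "t \<in> S" "\<And>s. s \<in> S \<Longrightarrow> f s \<le> f t"
proof -
  have "Max (f ` S) \<in> f ` S" using assms by (intro Max_in) auto
  then obtain t where t: "t \<in> S" "f t = Max (f ` S)" by (metis imageE)
  show ?thesis by (rule that[OF t(1)]) (use t(2) assms in simp)
qed

context based_root_system
begin

section \<open>Coordinates and heights with respect to the base\<close>

lemma D_subset: "D \<subseteq> R" and D_independent: "independent D"
  using base by (auto simp: is_base_def)

lemma D_root: "a \<in> D \<Longrightarrow> a \<in> R"
  using D_subset by blast

lemma finite_D [simp]: "finite D"
  using finite_subset[OF D_subset] by simp

lemma span_D: "span D = UNIV"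
proof -
  have "R \<subseteq> span D"
  proof
    fix b assume "b \<in> R"
    then obtain c where "b = (\<Sum>a\<in>D. real_of_int (c a) *\<^sub>R a)"
      using base unfolding is_base_def by blast
    then show "b \<in> span D" by (auto intro: span_sum span_scale span_base)
  qed
  then have "span R \<subseteq> span D" by (simp add: span_minimal)
  then show ?thesis using span_R by auto
qed

text \<open>The fundamental coweights, that is, the basis dual to \<open>D\<close>:
  \<open>v \<bullet> cw a\<close> is the coordinate of \<open>v\<close> at the simple root
  \<open>a\<close>.\<close>

definition cw :: "real^'n \<Rightarrow> real^'n" where
  "cw a = (SOME v. \<forall>b\<in>D. b \<bullet> v = (if b = a then 1 else 0))"

lemma simple_inner_cw:
  assumes "b \<in> D"
  shows "b \<bullet> cw a = (if b = a then 1 else 0)"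
proof -
  obtain g :: "real^'n \<Rightarrow> real"
    where g: "linear g" "\<forall>b\<in>D. g b = (if b = a then 1 else 0)"
    using linear_independent_extend[OF D_independent, of "\<lambda>b. if b = a then 1 else 0"] by metis
  then have "\<forall>b\<in>D. b \<bullet> adjoint g 1 = (if b = a then 1 else 0)"
    using adjoint_works[OF g(1)] by simp
  then have "\<forall>b\<in>D. b \<bullet> cw a = (if b = a then 1 else 0)"
    unfolding cw_def by (rule someI[where x = "adjoint g 1"])
  then show ?thesis using assms by blast
qed

lemma sum_D_inner_cw: "a \<in> D \<Longrightarrow> (\<Sum>b\<in>D. f b *\<^sub>R b) \<bullet> cw a = f a"
  by (simp add: inner_sum_left simple_inner_cw sum.delta' if_distrib cong: if_cong)

lemma simple_expansion: "v = (\<Sum>a\<in>D. (v \<bullet> cw a) *\<^sub>R a)"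
proof -
  obtain c where c: "v = (\<Sum>a\<in>D. c a *\<^sub>R a)"
    using span_D span_finite[OF finite_D] by blast
  have "v \<bullet> cw a = c a" if "a \<in> D" for a
    unfolding c by (rule sum_D_inner_cw[OF that])
  then show ?thesis using c by (simp cong: sum.cong)
qed

lemma inner_simple_expansion: "v \<bullet> w = (\<Sum>a\<in>D. (v \<bullet> cw a) * (a \<bullet> w))"
  by (subst simple_expansion[of v]) (simp add: inner_sum_left)

lemma eq_if_inner_cw_eq: "(\<And>a. a \<in> D \<Longrightarrow> v \<bullet> cw a = w \<bullet> cw a) \<Longrightarrow> v = w"
  by (subst simple_expansion[of v], subst simple_expansion[of w]) simp

lemma eq_if_inner_simple_eq:
  assumes "\<And>a. a \<in> D \<Longrightarrow> a \<bullet> v = a \<bullet> w"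
  shows "v = w"
proof -
  have "x \<bullet> v = x \<bullet> w" for x
    by (simp add: inner_simple_expansion[of x v] inner_simple_expansion[of x w] assms)
  then show ?thesis by (metis inner_commute vector_eq_rdot)
qed

text \<open>On roots this is positivity; it is defined on all of V in order to compare roots through
  their differences.\<close>

definition nonneg :: "real^'n \<Rightarrow> bool" where
  "nonneg v \<longleftrightarrow> (\<forall>a\<in>D. v \<bullet> cw a \<ge> 0)"

lemma root_inner_cw_int: "b \<in> R \<Longrightarrow> a \<in> D \<Longrightarrow> b \<bullet> cw a \<in> \<int>"
  and root_nonneg_cases: "b \<in> R \<Longrightarrow> nonneg b \<or> nonneg (- b)"
proof -
  assume "b \<in> R"
  then obtain c where c: "b = (\<Sum>a\<in>D. real_of_int (c a) *\<^sub>R a)"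
      "(\<forall>a\<in>D. c a \<ge> 0) \<or> (\<forall>a\<in>D. c a \<le> 0)"
    using base unfolding is_base_def by blast
  have *: "b \<bullet> cw a = c a" if "a \<in> D" for a
    unfolding c(1) by (rule sum_D_inner_cw[OF that])
  show "a \<in> D \<Longrightarrow> b \<bullet> cw a \<in> \<int>" by (simp add: *)
  show "nonneg b \<or> nonneg (- b)" using c(2) by (simp add: * nonneg_def)
qed

lemma nonneg_antisym: "nonneg v \<Longrightarrow> nonneg (- v) \<Longrightarrow> v = 0"
  by (rule eq_if_inner_cw_eq) (force simp: nonneg_def)

lemma nonneg_add: "nonneg v \<Longrightarrow> nonneg w \<Longrightarrow> nonneg (v + w)"
  by (simp add: nonneg_def inner_add_left)

lemma nonneg_simple: "a \<in> D \<Longrightarrow> nonneg a"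
  by (simp add: nonneg_def simple_inner_cw)

lemma refl_inner_cw:
  assumes "a \<in> D" "c \<in> D"
  shows "refl a b \<bullet> cw c = b \<bullet> cw c - (if c = a then b \<bullet> coroot a else 0)"
  using assms by (auto simp: refl_def inner_diff_left simple_inner_cw)

lemma root_multiple_simple:
  assumes b: "b \<in> R" "nonneg b" and a: "a \<in> D" and z: "\<And>c. c \<in> D \<Longrightarrow> c \<noteq> a \<Longrightarrow> b \<bullet> cw c = 0"
  shows "b = a"
proof -
  have "b = (b \<bullet> cw a) *\<^sub>R a"
    by (rule eq_if_inner_cw_eq) (use a z in \<open>auto simp: simple_inner_cw\<close>)
  moreover from this have "b \<bullet> cw a = 1 \<or> b \<bullet> cw a = -1"
    using reduced[OF D_root[OF a], of "b \<bullet> cw a"] b by simp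
  ultimately show ?thesis using b(2) a by (auto simp: nonneg_def)
qed

text \<open>\<open>refl a\<close> alters only the coordinate at \<open>a\<close>. A positive root
  made negative therefore has no other nonzero coordinate, and reducedness leaves only
  \<open>a\<close>.\<close>

lemma refl_simple_nonneg:
  assumes a: "a \<in> D" and b: "b \<in> R" "nonneg b" "b \<noteq> a"
  shows "nonneg (refl a b)"
proof (rule ccontr)
  assume "\<not> nonneg (refl a b)"
  then have "nonneg (- refl a b)"
    using root_nonneg_cases refl_root D_root a b by blast
  then have "b \<bullet> cw c = 0" if "c \<in> D" "c \<noteq> a" for c
    using that b(2) a by (force simp: nonneg_def refl_inner_cw)
  then show False using root_multiple_simple[OF b(1,2) a] b(3) by blast
qed

definition ht :: "real^'n \<Rightarrow> real" where
  "ht v = (\<Sum>a\<in>D. v \<bullet> cw a)"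

lemma ht_diff: "ht (v - w) = ht v - ht w"
  and ht_scale: "ht (c *\<^sub>R v) = c * ht v"
  by (simp_all add: ht_def inner_diff_left sum_subtractf sum_distrib_left)

lemma ht_simple: "a \<in> D \<Longrightarrow> ht a = 1"
  by (simp add: ht_def simple_inner_cw sum.delta)

lemma ht_refl_simple: "a \<in> D \<Longrightarrow> ht (refl a b) = ht b - b \<bullet> coroot a"
  by (simp add: refl_def ht_diff ht_scale ht_simple)

lemma ht_nonneg: "nonneg v \<Longrightarrow> ht v \<ge> 0"
  by (auto simp: ht_def nonneg_def intro: sum_nonneg)

lemma ht_eq_zero: "nonneg v \<Longrightarrow> ht v = 0 \<Longrightarrow> v = 0"
  by (rule eq_if_inner_cw_eq) (auto simp: ht_def nonneg_def sum_nonneg_eq_0_iff)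

lemma ht_int: "b \<in> R \<Longrightarrow> ht b \<in> \<int>"
  by (auto simp: ht_def intro: Ints_sum root_inner_cw_int)

text \<open>Expanding the positive number \<open>b \<bullet> b\<close> in simple roots gives a
  simple root \<open>a\<close> with \<open>b \<bullet> a > 0\<close>; unless \<open>b\<close> is
  simple, \<open>refl a b\<close> is again positive and lower by at least 1 in height.\<close>

lemma nonneg_root_induct [consumes 2, case_names simple step]:
  assumes "b \<in> R" "nonneg b"
    and simple: "\<And>a. a \<in> D \<Longrightarrow> P a"
    and step: "\<And>a b. a \<in> D \<Longrightarrow> b \<in> R \<Longrightarrow> nonneg b \<Longrightarrow> nonneg (refl a b) \<Longrightarrow> P (refl a b) \<Longrightarrow> P b"
  shows "P b"
  using assms(1,2)
proof (induction "nat \<lfloor>ht b\<rfloor>" arbitrary: b rule: less_induct)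
  case less
  show ?case
  proof (cases "b \<in> D")
    case False
    have "b \<bullet> b > 0" using less root_nonzero by simp
    moreover have "b \<bullet> b = (\<Sum>a\<in>D. (b \<bullet> cw a) * (b \<bullet> a))"
      by (subst inner_simple_expansion) (simp add: inner_commute)
    ultimately have "\<not> (\<forall>a\<in>D. (b \<bullet> cw a) * (b \<bullet> a) \<le> 0)"
      using sum_nonpos[of D "\<lambda>a. (b \<bullet> cw a) * (b \<bullet> a)"] by auto
    then obtain a where a: "a \<in> D" "(b \<bullet> cw a) * (b \<bullet> a) > 0" by force
    then have "b \<bullet> a > 0"
      using less(3) by (auto simp: nonneg_def zero_less_mult_iff)
    then have n: "b \<bullet> coroot a \<ge> 1"
      using Ints_pos_ge_one coroot_int coroot_inner_pos_iff D_root a(1) less(2) by blast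
    have r: "refl a b \<in> R" "nonneg (refl a b)"
      using refl_simple_nonneg[OF a(1) less(2,3)] False a(1) refl_root D_root less(2) by auto
    have "ht (refl a b) + 1 \<le> ht b" "ht (refl a b) \<ge> 0"
      using ht_refl_simple[OF a(1)] n ht_nonneg[OF r(2)] by auto
    then have "nat \<lfloor>ht (refl a b)\<rfloor> < nat \<lfloor>ht b\<rfloor>" by linarith
    then show ?thesis using step less r a(1) by blast
  qed (rule simple)
qed

lemma sum_D_delta:
  fixes f :: "real^'n \<Rightarrow> real^'n" and m :: int
  assumes "a \<in> D"
  shows "(\<Sum>b\<in>D. of_int (if b = a then m else 0) *\<^sub>R f b) = of_int m *\<^sub>R f a"
proof -
  have "(\<Sum>b\<in>D. of_int (if b = a then m else 0) *\<^sub>R f b) = (\<Sum>b\<in>D. if b = a then of_int m *\<^sub>R f b else 0)"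
    by (rule sum.cong) auto
  then show ?thesis using assms by simp
qed

text \<open>Leads to \<open>wlat_iff\<close>: weights can be tested on simple coroots. In the
  reflection step only the coefficient at \<open>coroot a\<close> changes, by the integer
  \<open>a \<bullet> coroot (refl a b)\<close>.\<close>

lemma nonneg_root_coroot_expansion:
  assumes "b \<in> R" "nonneg b"
  shows "\<exists>c :: real^'n \<Rightarrow> int. coroot b = (\<Sum>a\<in>D. of_int (c a) *\<^sub>R coroot a)"
  using assms
proof (induction rule: nonneg_root_induct)
  case (simple a)
  have "coroot a = (\<Sum>b\<in>D. of_int (if b = a then 1 else 0) *\<^sub>R coroot b)"
    using sum_D_delta[OF simple, of 1 coroot] by simp
  then show ?case by (rule exI[of _ "\<lambda>b. if b = a then 1 else 0"])
next
  case (step a b)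
  then obtain c :: "real^'n \<Rightarrow> int" where c: "coroot (refl a b) = (\<Sum>a\<in>D. of_int (c a) *\<^sub>R coroot a)"
    by blast
  obtain m where m: "a \<bullet> coroot (refl a b) = of_int m"
    using coroot_int[OF refl_root[of a b] D_root[of a]] step D_root Ints_cases by metis
  have "coroot b = refl a (coroot (refl a b))"
    using coroot_orthogonal[OF orthogonal_transformation_refl] by (metis refl_refl)
  also have "\<dots> = coroot (refl a b) - of_int m *\<^sub>R coroot a"
    using refl_coroot_form[of a "coroot (refl a b)"] m by simp
  also have "\<dots> = (\<Sum>b\<in>D. of_int (c b - (if b = a then m else 0)) *\<^sub>R coroot b)"
    using sum_D_delta[OF step(1), of m coroot] c by (simp add: scaleR_diff_left sum_subtractf)
  finally show ?case by (rule exI[of _ "\<lambda>b. c b - (if b = a then m else 0)"])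
qed

lemma coroot_expansion:
  assumes "b \<in> R"
  shows "\<exists>c :: real^'n \<Rightarrow> int. coroot b = (\<Sum>a\<in>D. of_int (c a) *\<^sub>R coroot a)"
proof (cases "nonneg b")
  case False
  then obtain c :: "real^'n \<Rightarrow> int" where c: "coroot (- b) = (\<Sum>a\<in>D. of_int (c a) *\<^sub>R coroot a)"
    using nonneg_root_coroot_expansion[of "- b"] root_nonneg_cases assms by auto
  then have "coroot b = (\<Sum>a\<in>D. of_int (- c a) *\<^sub>R coroot a)"
    by (simp add: coroot_minus sum_negf) (metis minus_minus)
  then show ?thesis by (rule exI[of _ "\<lambda>a. - c a"])
qed (use nonneg_root_coroot_expansion assms in blast)

lemma wlat_iff: "l \<in> wlat R \<longleftrightarrow> (\<forall>a\<in>D. l \<bullet> coroot a \<in> \<int>)"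
proof
  assume *: "\<forall>a\<in>D. l \<bullet> coroot a \<in> \<int>"
  have "l \<bullet> coroot b \<in> \<int>" if b: "b \<in> R" for b
  proof -
    from coroot_expansion[OF b] obtain c :: "real^'n \<Rightarrow> int"
      where "coroot b = (\<Sum>a\<in>D. of_int (c a) *\<^sub>R coroot a)" ..
    then show ?thesis using * by (simp add: inner_sum_right Ints_sum)
  qed
  then show "l \<in> wlat R" by (simp add: wlat_def)
qed (auto simp: wlat_def D_root)

lemma cowlat_iff: "v \<in> cowlat R \<longleftrightarrow> (\<forall>a\<in>D. a \<bullet> v \<in> \<int>)"
proof
  assume *: "\<forall>a\<in>D. a \<bullet> v \<in> \<int>"
  have "b \<bullet> v \<in> \<int>" if "b \<in> R" for b
    by (subst inner_simple_expansion) (use * root_inner_cw_int[OF that] in \<open>auto intro!: Ints_sum\<close>)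
  then show "v \<in> cowlat R" by (simp add: cowlat_def)
qed (auto simp: cowlat_def D_root)

section \<open>Existence of the highest root\<close>

lemma root_diff:
  assumes a: "a \<in> R" and b: "b \<in> R" and pos: "a \<bullet> b > 0" and ne: "a \<noteq> b"
  shows "a - b \<in> R"
proof -
  let ?m = "a \<bullet> coroot b" and ?n = "b \<bullet> coroot a"
  have ab: "a \<bullet> a > 0" "b \<bullet> b > 0" using root_nonzero a b by auto
  have m: "?m \<in> \<int>" "?m \<ge> 1" and n: "?n \<in> \<int>" "?n \<ge> 1"
    using Ints_pos_ge_one coroot_int coroot_inner_pos_iff a b pos by (auto simp: inner_commute)
  \<comment> \<open>If both Cartan integers were at least 2, neither squared length would exceed
    \<open>a \<bullet> b\<close>, forcing the squared length of \<open>a - b\<close> to be at most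
    0. With one of them equal to 1, the corresponding reflection produces the difference.\<close>
  have "?m = 1 \<or> ?n = 1"
  proof (rule ccontr)
    assume "\<not> ?thesis"
    then have "?m \<ge> 2" "?n \<ge> 2" using m n by (auto elim!: Ints_cases)
    then have le: "a \<bullet> a \<le> a \<bullet> b" "b \<bullet> b \<le> a \<bullet> b"
      using ab by (auto simp: inner_coroot field_simps inner_commute)
    have "(a - b) \<bullet> (a - b) \<le> 0"
      using le by (simp add: inner_diff_left inner_diff_right inner_commute)
    then show False using ne inner_gt_zero_iff[of "a - b"] by (metis not_less right_minus_eq)
  qed
  then show ?thesis
  proof
    assume "?m = 1"
    then show ?thesis using refl_root[OF b a] by (simp add: refl_def)
  next
    assume "?n = 1"
    then have "b - a \<in> R" using refl_root[OF a b] by (simp add: refl_def)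
    then show ?thesis by (metis minus_diff_eq minus_root)
  qed
qed

text \<open>Otherwise \<open>a - b\<close> would be a root with coordinates of both signs.\<close>

lemma simple_obtuse:
  assumes "a \<in> D" "b \<in> D" "a \<noteq> b"
  shows "a \<bullet> b \<le> 0"
proof (rule ccontr)
  assume "\<not> ?thesis"
  then have "a - b \<in> R" using root_diff assms D_root by auto
  then have "nonneg (a - b) \<or> nonneg (b - a)" using root_nonneg_cases by fastforce
  then show False using assms by (auto simp: nonneg_def inner_diff_left simple_inner_cw)
qed

text \<open>A root with nonzero components in both of two orthogonal parts of the base would, after
  reflecting down, give a simple root with the same property.\<close>

lemma simple_indecomposable:
  assumes D: "D = I \<union> J" and orth: "\<And>a b. a \<in> I \<Longrightarrow> b \<in> J \<Longrightarrow> a \<bullet> b = 0"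
  shows "I = {} \<or> J = {}"
proof -
  define U where "U S = {v. \<forall>a\<in>S. a \<bullet> v = 0}" for S :: "(real^'n) set"
  have refl_U: "refl a v \<in> U S" if "v \<in> U S" "a \<in> U S" for a v S
    using that by (simp add: U_def refl_def inner_diff_right)
  have refl_U': "refl a v \<in> U S" if "v \<in> U S" "a \<in> S" for a v S
  proof -
    have "v \<bullet> coroot a = 0" using that by (simp add: U_def inner_coroot inner_commute)
    then show ?thesis using that by (simp add: refl_def)
  qed
  have UI: "a \<in> U J" if "a \<in> I" for a
    using orth[OF that] by (simp add: U_def) (metis inner_commute)
  have UJ: "a \<in> U I" if "a \<in> J" for a
    using that orth by (simp add: U_def)
  have *: "b \<in> U I \<union> U J" if "b \<in> R" "nonneg b" for b
    using that
  proof (induction rule: nonneg_root_induct)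
    case (simple a)
    then show ?case using D UI UJ by blast
  next
    case (step a b)
    then have "refl a (refl a b) \<in> U I \<union> U J"
      using D UI UJ refl_U refl_U' by blast
    then show ?case by simp
  qed
  have "b \<in> U I \<union> U J" if "b \<in> R" for b
    using *[of b] *[of "- b"] root_nonneg_cases[OF that] that by (auto simp: U_def)
  then have R: "R = (R \<inter> U J) \<union> (R \<inter> U I)" by blast
  have "R \<inter> U J = {} \<or> R \<inter> U I = {}"
  proof (rule irreducible[OF R])
    fix a b assume a: "a \<in> R \<inter> U J" and b: "b \<in> R \<inter> U I"
    \<comment> \<open>The part \<open>w\<close> of \<open>a\<close> along J satisfies
      \<open>w \<bullet> w = a \<bullet> w = 0\<close>: the first equality because the part along I
      is orthogonal to J, the second because \<open>a\<close> is.\<close>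
    have "a \<bullet> cw c = 0" if "c \<in> J" for c
    proof -
      define w where "w = (\<Sum>c\<in>J. (a \<bullet> cw c) *\<^sub>R c)"
      have fin: "finite I" "finite J" using finite_D D by auto
      have "I \<inter> J = {}"
        using orth D_root root_nonzero D by (metis Un_iff disjoint_iff inner_eq_zero_iff)
      define v where "v = (\<Sum>c\<in>I. (a \<bullet> cw c) *\<^sub>R c)"
      have a_eq: "a = v + w"
        using simple_expansion[of a] \<open>I \<inter> J = {}\<close> unfolding v_def w_def D
        by (simp add: sum.union_disjoint fin)
      have "v \<bullet> w = 0"
        by (auto simp: v_def w_def inner_sum_left inner_sum_right orth intro!: sum.neutral)
      then have "a \<bullet> w = w \<bullet> w" by (subst a_eq) (simp add: inner_add_left)
      moreover have "a \<bullet> w = 0"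
        using a by (auto simp: w_def inner_sum_right U_def inner_commute intro!: sum.neutral)
      ultimately have "w = 0" by simp
      then have "(\<Sum>b\<in>D. (if b \<in> J then a \<bullet> cw b else 0) *\<^sub>R b) = 0"
        unfolding w_def D using fin \<open>I \<inter> J = {}\<close>
        by (subst sum.union_disjoint) (auto intro!: sum.neutral)
      then show ?thesis
        using sum_D_inner_cw[of c "\<lambda>b. if b \<in> J then a \<bullet> cw b else 0"] that D by simp
    qed
    then show "a \<bullet> b = 0"
      using D b by (subst inner_simple_expansion) (auto simp: U_def intro!: sum.neutral)
  qed
  then show ?thesis using UI UJ D D_root by blast
qed

lemma D_nonempty: "D \<noteq> {}"
proof
  assume "D = {}"
  then have "(UNIV :: (real^'n) set) = {0}" using span_D by simp
  then have "(axis undefined 1 :: real^'n) = 0" by blast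
  then show False by (simp add: axis_eq_0_iff)
qed

lemma R_nonempty: "R \<noteq> {}"
  using D_nonempty D_root by blast

text \<open>A root \<open>t\<close> of maximal height is dominant, and irreducibility gives it full
  support, so it pairs positively with every nonzero dominant vector. Every root \<open>b\<close>
  lies below a dominant root \<open>c\<close>; then \<open>t - c\<close> is zero or a root, and
  maximality of the height makes it nonnegative.\<close>

lemma highest_root_exists:
  "\<exists>t\<in>R. \<forall>b\<in>R. nonneg (t - b)"
proof -
  \<comment> \<open>Formulated for a set S because it is applied twice: to R for \<open>t\<close>,
    and to the roots above \<open>b\<close> for \<open>c\<close>.\<close>
  have dominant: "b \<bullet> a \<ge> 0"
    if b: "b \<in> S" "\<And>c. c \<in> S \<Longrightarrow> ht c \<le> ht b" "\<And>a c. a \<in> D \<Longrightarrow> c \<in> S \<Longrightarrow> c \<bullet> a < 0 \<Longrightarrow> refl a c \<in> S"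
      and a: "a \<in> D" for a b S
  proof (rule ccontr)
    assume neg: "\<not> ?thesis"
    then have "ht (refl a b) \<le> ht b" using b a by auto
    moreover have "b \<bullet> coroot a < 0"
      using neg root_nonzero[OF D_root[OF a]] by (simp add: inner_coroot divide_neg_pos)
    ultimately show False using ht_refl_simple[OF a, of b] by simp
  qed
  obtain t where t: "t \<in> R" "\<And>b. b \<in> R \<Longrightarrow> ht b \<le> ht t"
    using finite_maximizer[OF finite_R R_nonempty, of ht] by blast
  have tdom: "t \<bullet> a \<ge> 0" if "a \<in> D" for a
    by (rule dominant[of t R]) (use t refl_root D_root that in auto)
  have tpos: "nonneg t"
  proof (rule ccontr)
    assume "\<not> nonneg t"
    then have n: "nonneg (- t)" using root_nonneg_cases t(1) by blast
    have "ht (- t) \<le> ht t" "ht (- t) = - ht t"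
      using t(1) t(2)[of "- t"] ht_scale[of "-1" t] by auto
    then have "ht (- t) = 0" using ht_nonneg[OF n] by linarith
    then show False using ht_eq_zero[OF n] root_nonzero t(1) by force
  qed
  \<comment> \<open>For j outside the support, \<open>t \<bullet> j\<close> is nonnegative by
    dominance, while all terms of its expansion are nonpositive by \<open>simple_obtuse\<close>. So
    they vanish, and the support is orthogonal to its complement.\<close>
  have full: "t \<bullet> cw a > 0" if "a \<in> D" for a
  proof -
    define I where "I = {a\<in>D. t \<bullet> cw a > 0}"
    define J where "J = {a\<in>D. t \<bullet> cw a = 0}"
    have D: "D = I \<union> J" using tpos by (auto simp: I_def J_def nonneg_def less_le)
    have "i \<bullet> j = 0" if i: "i \<in> I" and j: "j \<in> J" for i j
    proof -
      have "t \<bullet> j = (\<Sum>a\<in>D. (t \<bullet> cw a) * (a \<bullet> j))" by (rule inner_simple_expansion)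
      moreover have le: "(t \<bullet> cw a) * (a \<bullet> j) \<le> 0" if "a \<in> D" for a
      proof (cases "a = j")
        case False
        then have "a \<bullet> j \<le> 0" using simple_obtuse[of a j] that j D by blast
        moreover have "t \<bullet> cw a \<ge> 0" using tpos that by (simp add: nonneg_def)
        ultimately show ?thesis by (rule mult_nonneg_nonpos[rotated])
      qed (use j in \<open>simp add: J_def\<close>)
      moreover have "t \<bullet> j \<ge> 0" using tdom j D by auto
      ultimately have "(\<Sum>a\<in>D. - ((t \<bullet> cw a) * (a \<bullet> j))) = 0"
        using sum_nonpos[of D "\<lambda>a. (t \<bullet> cw a) * (a \<bullet> j)"] by (simp add: sum_negf)
      then have "\<forall>a\<in>D. - ((t \<bullet> cw a) * (a \<bullet> j)) = 0"
        using le by (subst (asm) sum_nonneg_eq_0_iff) (auto simp: neg_le_0_iff_le)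
      then have "(t \<bullet> cw i) * (i \<bullet> j) = 0"
        using i by (auto simp: I_def)
      then show ?thesis using i by (simp add: I_def)
    qed
    then have "I = {} \<or> J = {}" using simple_indecomposable D by blast
    moreover have "I \<noteq> {}"
    proof
      assume "I = {}"
      then have "t = 0" using D by (intro eq_if_inner_cw_eq) (auto simp: J_def)
      then show False using root_nonzero t by blast
    qed
    ultimately have "a \<in> I" using D that by blast
    then show ?thesis by (simp add: I_def)
  qed
  have "nonneg (t - b)" if b: "b \<in> R" for b
  proof -
    define S where "S = {c\<in>R. nonneg (c - b)}"
    have "b \<in> S" "finite S" using b by (auto simp: S_def nonneg_def)
    then obtain c where c: "c \<in> S" "\<And>d. d \<in> S \<Longrightarrow> ht d \<le> ht c"
      using finite_maximizer[of S ht] by blast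
    have "refl a d \<in> S" if "a \<in> D" "d \<in> S" "d \<bullet> a < 0" for a d
    proof -
      have "d \<bullet> coroot a \<le> 0" using that(3)
        by (simp add: inner_coroot divide_nonpos_nonneg)
      then have "nonneg (- ((d \<bullet> coroot a) *\<^sub>R a))"
        using nonneg_simple[OF that(1)] by (auto simp: nonneg_def mult_nonpos_nonneg)
      then have "nonneg (refl a d - b)"
        using nonneg_add[of "d - b" "- ((d \<bullet> coroot a) *\<^sub>R a)"] that(2)
        by (simp add: S_def refl_def algebra_simps)
      then show ?thesis using that refl_root D_root by (simp add: S_def)
    qed
    then have cdom: "c \<bullet> a \<ge> 0" if "a \<in> D" for a
      using dominant[of c S a] c that by blast
    have cR: "c \<in> R" "c \<noteq> 0" using c(1) root_nonzero by (auto simp: S_def)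
    have "t \<bullet> c > 0"
    proof -
      obtain a where a: "a \<in> D" "c \<bullet> a \<noteq> 0"
        using eq_if_inner_simple_eq[of c 0] cR by (auto simp: inner_commute)
      have nn: "(t \<bullet> cw d) * (d \<bullet> c) \<ge> 0" if "d \<in> D" for d
        using full[OF that] cdom[OF that] by (simp add: inner_commute)
      have "(t \<bullet> cw a) * (a \<bullet> c) > 0"
        using full[OF a(1)] cdom[OF a(1)] a(2) by (simp add: inner_commute)
      then have "(\<Sum>a\<in>D. (t \<bullet> cw a) * (a \<bullet> c)) > 0"
        by (rule sum_pos2[OF finite_D a(1) _ nn])
      then show ?thesis using inner_simple_expansion[of t c] by simp
    qed
    have "nonneg (t - c)"
    proof (cases "t = c")
      case False
      then have d: "t - c \<in> R" using root_diff \<open>t \<bullet> c > 0\<close> t(1) cR by blast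
      show ?thesis
      proof (rule ccontr)
        assume "\<not> nonneg (t - c)"
        then have n: "nonneg (c - t)" using root_nonneg_cases[OF d] by simp
        then have "ht (c - t) = 0" using ht_nonneg[OF n] t(2)[OF cR(1)] by (simp add: ht_diff)
        then show False using ht_eq_zero[OF n] False by simp
      qed
    qed (simp add: nonneg_def)
    then show ?thesis using nonneg_add[of "t - c" "c - b"] c(1) by (simp add: S_def)
  qed
  then show ?thesis using t(1) by blast
qed

lemma nonneg_int_span_D: "v \<in> nonneg_int_span D \<longleftrightarrow> nonneg v \<and> (\<forall>a\<in>D. v \<bullet> cw a \<in> \<int>)"
proof
  assume "v \<in> nonneg_int_span D"
  then obtain c :: "real^'n \<Rightarrow> int" where c: "v = (\<Sum>a\<in>D. of_int (c a) *\<^sub>R a)" "\<forall>a\<in>D. c a \<ge> 0"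
    unfolding nonneg_int_span_def by blast
  have "v \<bullet> cw a = c a" if "a \<in> D" for a
    unfolding c(1) by (rule sum_D_inner_cw[OF that])
  then show "nonneg v \<and> (\<forall>a\<in>D. v \<bullet> cw a \<in> \<int>)" using c(2) by (simp add: nonneg_def)
next
  assume *: "nonneg v \<and> (\<forall>a\<in>D. v \<bullet> cw a \<in> \<int>)"
  have "v = (\<Sum>a\<in>D. of_int \<lfloor>v \<bullet> cw a\<rfloor> *\<^sub>R a)"
    by (subst simple_expansion[of v], rule sum.cong) (use * in \<open>auto elim!: Ints_cases\<close>)
  moreover have "\<forall>a\<in>D. \<lfloor>v \<bullet> cw a\<rfloor> \<ge> 0" using * by (simp add: nonneg_def)
  ultimately show "v \<in> nonneg_int_span D"
    unfolding nonneg_int_span_def by (auto intro!: exI[of _ "\<lambda>a. \<lfloor>v \<bullet> cw a\<rfloor>"])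
qed

abbreviation "\<theta> \<equiv> highest_root R D"

lemma highest_root: "\<theta> \<in> R" "b \<in> R \<Longrightarrow> nonneg (\<theta> - b)"
proof -
  let ?P = "\<lambda>t. t \<in> R \<and> (\<forall>b\<in>R. t - b \<in> nonneg_int_span D)"
  have eq: "?P t \<longleftrightarrow> t \<in> R \<and> (\<forall>b\<in>R. nonneg (t - b))" for t
    by (auto simp: nonneg_int_span_D inner_diff_left root_inner_cw_int)
  obtain t where t: "?P t" using highest_root_exists eq by blast
  have "?P \<theta>" unfolding highest_root_def
  proof (rule theI[where a = t])
    show "?P t" by (rule t)
    fix s assume "?P s"
    then show "s = t"
      using t nonneg_antisym[of "s - t"] unfolding eq by auto
  qed
  then show "\<theta> \<in> R" "b \<in> R \<Longrightarrow> nonneg (\<theta> - b)" unfolding eq by auto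
qed

lemma highest_root_inner_cw: "a \<in> D \<Longrightarrow> \<theta> \<bullet> cw a \<ge> 1"
  using highest_root(2)[OF D_root, of a]
  by (auto simp: nonneg_def inner_diff_left simple_inner_cw split: if_splits dest: bspec[of _ _ a])

end

subsection \<open>The affine Weyl group\<close>

text \<open>The pair (a, k) stands for the affine function v |-> a . v + k.\<close>

definition ev :: "(real^'n) \<times> int \<Rightarrow> real^'n \<Rightarrow> real" where
  "ev f v = fst f \<bullet> v + of_int (snd f)"

definition affine_refl :: "(real^'n) \<times> int \<Rightarrow> real^'n \<Rightarrow> real^'n" where
  "affine_refl f v = v - ev f v *\<^sub>R coroot (fst f)"

text \<open>The affine root \<open>f\<close> composed with \<open>affine_refl h\<close>
  (\<open>ev_affine_refl\<close>). For roots the pairing is an integer, and the floor only changes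
  its type.\<close>

definition reflect_root :: "(real^'n) \<times> int \<Rightarrow> (real^'n) \<times> int \<Rightarrow> (real^'n) \<times> int" where
  "reflect_root h f = (refl (fst h) (fst f), snd f - snd h * \<lfloor>fst f \<bullet> coroot (fst h)\<rfloor>)"

definition refl_word :: "((real^'n) \<times> int) list \<Rightarrow> real^'n \<Rightarrow> real^'n" where
  "refl_word fs = foldr (\<lambda>f g. affine_refl f \<circ> g) fs id"

lemma refl_word_Nil [simp]: "refl_word [] = id"
  and refl_word_Cons [simp]: "refl_word (f # fs) = affine_refl f \<circ> refl_word fs"
  by (simp_all add: refl_word_def)

lemma refl_word_append: "refl_word (fs @ gs) = refl_word fs \<circ> refl_word gs"
  by (induction fs) (simp_all add: comp_assoc)

lemma affine_refl_eq: "affine_refl (a, k) v = refl a v - of_int k *\<^sub>R coroot a"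
  by (simp add: affine_refl_def ev_def refl_coroot_form scaleR_add_left)

lemma affine_refl_zero: "affine_refl (a, 0) = refl a"
  by (rule ext) (simp add: affine_refl_eq)

lemma ev_uminus: "ev (- f) v = - ev f v"
  by (simp add: ev_def)

lemma affine_refl_uminus: "affine_refl (- f) = affine_refl f"
  by (rule ext) (simp add: affine_refl_def ev_uminus coroot_minus)

context based_root_system
begin

section \<open>Affine roots, the fundamental alcove and the exchange argument\<close>

definition aroots :: "((real^'n) \<times> int) set" where
  "aroots = R \<times> UNIV"

definition walls :: "((real^'n) \<times> int) set" where
  "walls = (\<lambda>a. (a, 0)) ` D \<union> {(- \<theta>, 1)}"

text \<open>An affine root is a combination of the walls (\<open>ev_expansion\<close>): its
  coefficient at \<open>(- \<theta>, 1)\<close> is \<open>snd f\<close>, and those at the simple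
  roots are the coordinates of \<open>fst f + of_int (snd f) *\<^sub>R \<theta>\<close>. Positive
  means that none of them is negative.\<close>

definition apos :: "(real^'n) \<times> int \<Rightarrow> bool" where
  "apos f \<longleftrightarrow> snd f \<ge> 0 \<and> nonneg (fst f + of_int (snd f) *\<^sub>R \<theta>)"

text \<open>The sum of the coefficients in the walls, so that each wall has affine height 1.\<close>

definition aht :: "(real^'n) \<times> int \<Rightarrow> real" where
  "aht f = ht (fst f + of_int (snd f) *\<^sub>R \<theta>) + of_int (snd f)"

abbreviation "C \<equiv> alcove R D"

lemma wallE:
  assumes "h \<in> walls"
  obtains a where "a \<in> D" "h = (a, 0)" | "h = (- \<theta>, 1)"
  using assms by (auto simp: walls_def)

lemma simple_wall: "a \<in> D \<Longrightarrow> (a, 0) \<in> walls" and highest_wall: "(- \<theta>, 1) \<in> walls"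
  by (auto simp: walls_def)

lemma aroots_iff: "f \<in> aroots \<longleftrightarrow> fst f \<in> R"
  by (cases f) (simp add: aroots_def)

lemma walls_aroots: "h \<in> walls \<Longrightarrow> h \<in> aroots"
  by (erule wallE) (simp_all add: aroots_iff D_root highest_root(1))

lemma aroots_uminus: "f \<in> aroots \<Longrightarrow> - f \<in> aroots"
  by (simp add: aroots_iff)

lemma reflect_root_aroots: "h \<in> aroots \<Longrightarrow> f \<in> aroots \<Longrightarrow> reflect_root h f \<in> aroots"
  by (simp add: aroots_iff reflect_root_def refl_root)

lemma alcove_iff: "v \<in> C \<longleftrightarrow> (\<forall>h\<in>walls. ev h v > 0)"
  by (auto simp: alcove_def walls_def ev_def)

lemma aroot_floor: "f \<in> aroots \<Longrightarrow> h \<in> aroots \<Longrightarrow>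
    of_int \<lfloor>fst f \<bullet> coroot (fst h)\<rfloor> = fst f \<bullet> coroot (fst h)"
  using coroot_int by (intro of_int_floor_Ints) (simp add: aroots_iff)

lemma ev_affine_refl:
  assumes "f \<in> aroots" "h \<in> aroots"
  shows "ev f (affine_refl h v) = ev (reflect_root h f) v"
proof -
  have "fst f \<bullet> coroot (fst h) = of_int \<lfloor>fst f \<bullet> coroot (fst h)\<rfloor>"
    by (rule aroot_floor[OF assms, symmetric])
  then show ?thesis
    by (simp add: ev_def affine_refl_def reflect_root_def refl_def inner_diff_left inner_diff_right
        algebra_simps)
qed

lemma ev_affine_refl_self: "h \<in> aroots \<Longrightarrow> ev h (affine_refl h v) = - ev h v"
  by (simp add: aroots_iff ev_def affine_refl_def inner_diff_right coroot_self root_nonzero)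

lemma affine_refl_refl: "h \<in> aroots \<Longrightarrow> affine_refl h (affine_refl h v) = v"
  using ev_affine_refl_self[of h v] by (simp add: affine_refl_def[of h "affine_refl h v"])
     (simp add: affine_refl_def)

lemma affine_refl_conj:
  assumes "f \<in> aroots" "h \<in> aroots"
  shows "affine_refl f \<circ> affine_refl h = affine_refl h \<circ> affine_refl (reflect_root h f)"
proof
  fix v
  let ?e = "ev (reflect_root h f) v"
  have "coroot (fst (reflect_root h f)) = refl (fst h) (coroot (fst f))"
    by (simp add: reflect_root_def coroot_orthogonal[OF orthogonal_transformation_refl])
  moreover have "affine_refl h (v - ?e *\<^sub>R refl (fst h) (coroot (fst f))) =
      affine_refl h v - ?e *\<^sub>R coroot (fst f)"
    by (cases h) (simp add: affine_refl_eq linear_diff[OF linear_refl] linear_scale[OF linear_refl])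
  ultimately show "(affine_refl f \<circ> affine_refl h) v = (affine_refl h \<circ> affine_refl (reflect_root h f)) v"
    using ev_affine_refl[OF assms, of v] by (simp add: affine_refl_def[of f] affine_refl_def[of "reflect_root h f"])
qed

lemma nonneg_highest: "nonneg \<theta>"
  using highest_root_inner_cw by (force simp: nonneg_def)

lemma nonneg_scale: "c \<ge> 0 \<Longrightarrow> nonneg v \<Longrightarrow> nonneg (c *\<^sub>R v)"
  by (simp add: nonneg_def)

text \<open>Here the maximality of \<theta> enters: it dominates the root \<open>- fst f\<close>,
  and the remaining levels only add multiples of \<theta>.\<close>

lemma apos_if_level_pos:
  assumes "f \<in> aroots" "snd f \<ge> 1"
  shows "apos f"
proof -
  have "nonneg (\<theta> - (- fst f))"
    using assms by (intro highest_root(2)) (simp add: aroots_iff)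
  moreover have "nonneg ((of_int (snd f) - 1) *\<^sub>R \<theta>)"
    using assms by (intro nonneg_scale nonneg_highest) simp
  moreover have "fst f + of_int (snd f) *\<^sub>R \<theta> = (\<theta> - (- fst f)) + (of_int (snd f) - 1) *\<^sub>R \<theta>"
    by (simp add: algebra_simps)
  ultimately have "nonneg (fst f + of_int (snd f) *\<^sub>R \<theta>)"
    using nonneg_add by metis
  then show ?thesis using assms by (simp add: apos_def)
qed

lemma apos_cases:
  assumes "f \<in> aroots"
  shows "apos f \<or> apos (- f)"
proof -
  consider "snd f \<ge> 1" | "snd (- f) \<ge> 1" | "snd f = 0" by force
  then show ?thesis
  proof cases
    case 3
    then show ?thesis using assms root_nonneg_cases by (simp add: apos_def aroots_iff)
  qed (use assms aroots_uminus apos_if_level_pos in blast)+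
qed

lemma ev_expansion:
  "ev f v = (\<Sum>a\<in>D. ((fst f + of_int (snd f) *\<^sub>R \<theta>) \<bullet> cw a) * (a \<bullet> v)) + of_int (snd f) * (1 - \<theta> \<bullet> v)"
proof -
  have "ev f v = (fst f + of_int (snd f) *\<^sub>R \<theta>) \<bullet> v + of_int (snd f) * (1 - \<theta> \<bullet> v)"
    by (simp add: ev_def inner_add_left algebra_simps)
  then show ?thesis by (subst (asm) inner_simple_expansion)
qed

lemma nonneg_inner_pos:
  assumes "nonneg v" "v \<noteq> 0" and p: "\<And>a. a \<in> D \<Longrightarrow> a \<bullet> p > 0"
  shows "v \<bullet> p > 0"
proof -
  obtain a where a: "a \<in> D" "v \<bullet> cw a \<noteq> 0"
    using eq_if_inner_cw_eq[of v 0] assms by auto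
  have "(\<Sum>a\<in>D. (v \<bullet> cw a) * (a \<bullet> p)) > 0"
    by (rule sum_pos2[OF finite_D a(1)]) (use assms a p in \<open>auto simp: nonneg_def less_le\<close>)
  then show ?thesis using inner_simple_expansion[of v p] by simp
qed

lemma alcove_simple: "p \<in> C \<Longrightarrow> a \<in> D \<Longrightarrow> a \<bullet> p > 0" and alcove_highest: "p \<in> C \<Longrightarrow> \<theta> \<bullet> p < 1"
  by (simp_all add: alcove_def)

lemma apos_ev_pos:
  assumes f: "f \<in> aroots" "apos f" and p: "p \<in> C"
  shows "ev f p > 0"
proof (cases "snd f = 0")
  case True
  then show ?thesis
    using nonneg_inner_pos[of "fst f" p] alcove_simple[OF p] f root_nonzero
    by (simp add: apos_def ev_def aroots_iff)
next
  case False
  then have "of_int (snd f) * (1 - \<theta> \<bullet> p) > 0"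
    using f alcove_highest[OF p] by (simp add: apos_def)
  moreover have "(\<Sum>a\<in>D. ((fst f + of_int (snd f) *\<^sub>R \<theta>) \<bullet> cw a) * (a \<bullet> p)) \<ge> 0"
    using f(2) alcove_simple[OF p]
    by (intro sum_nonneg mult_nonneg_nonneg) (auto simp: apos_def nonneg_def less_imp_le)
  ultimately show ?thesis unfolding ev_expansion by linarith
qed

text \<open>An affine root has constant sign on C, since it or its negative is a nonnegative
  combination of the walls. All later arguments thus need only one point of C.\<close>

lemma ev_pos_iff:
  assumes f: "f \<in> aroots" and p: "p \<in> C"
  shows "ev f p > 0 \<longleftrightarrow> apos f"
  using apos_ev_pos[OF f _ p] apos_ev_pos[OF aroots_uminus[OF f] _ p] apos_cases[OF f]
  by (auto simp: ev_uminus)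

lemma ev_neg_iff:
  assumes f: "f \<in> aroots" and p: "p \<in> C"
  shows "ev f p < 0 \<longleftrightarrow> \<not> apos f"
  using apos_ev_pos[OF f _ p] apos_ev_pos[OF aroots_uminus[OF f] _ p] apos_cases[OF f]
  by (auto simp: ev_uminus)

text \<open>A wall of C is the only hyperplane separating C from its mirror image.\<close>

lemma apos_reflect_wall:
  assumes h: "h \<in> walls" and f: "f \<in> aroots" "apos f" and neg: "\<not> apos (reflect_root h f)"
  shows "f = h"
proof -
  obtain a k where fak: "f = (a, k)" by (cases f)
  have a: "a \<in> R" and k: "k \<ge> 0" and nn: "nonneg (a + of_int k *\<^sub>R \<theta>)"
    using f by (auto simp: fak aroots_iff apos_def)
  have "apos (- reflect_root h f)"
    using neg apos_cases reflect_root_aroots walls_aroots h f by blast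
  then have k': "snd (reflect_root h f) \<le> 0"
    and nn': "nonneg (- fst (reflect_root h f) - of_int (snd (reflect_root h f)) *\<^sub>R \<theta>)"
    by (auto simp: apos_def)
  show ?thesis using h
  proof (cases rule: wallE)
    case (1 b)
    then have "k = 0" using k k' by (simp add: fak reflect_root_def)
    then have "nonneg (- refl b a)" "nonneg a" using nn nn' 1 by (simp_all add: fak reflect_root_def)
    then have "a = b"
      using refl_simple_nonneg[of b a] nonneg_antisym[of "refl b a"] refl_root[of b a] 1 a D_root root_nonzero
      by blast
    then show ?thesis using 1 \<open>k = 0\<close> fak by simp
  next
    case 2
    obtain m where m: "a \<bullet> coroot \<theta> = of_int m"
      using coroot_int[OF highest_root(1) a] by (elim Ints_cases)
    \<comment> \<open>Reflecting in this wall subtracts a multiple of it, which leaves the simple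
      coefficients, those of \<open>a + of_int k *\<^sub>R \<theta>\<close>, unchanged.\<close>
    have "- fst (reflect_root h f) - of_int (snd (reflect_root h f)) *\<^sub>R \<theta> = - (a + of_int k *\<^sub>R \<theta>)"
      by (simp add: fak reflect_root_def 2 refl_def coroot_minus m algebra_simps)
    then have "a + of_int k *\<^sub>R \<theta> = 0" using nonneg_antisym[OF nn] nn' by simp
    then have eq: "a = of_int (- k) *\<^sub>R \<theta>" by (simp add: eq_neg_iff_add_eq_0)
    then have "real_of_int (- k) = 1 \<or> real_of_int (- k) = - 1"
      using reduced[OF highest_root(1), of "of_int (- k)"] a by metis
    then have "k = 1" using k by auto
    then show ?thesis using eq 2 fak by simp
  qed
qed

text \<open>Move the reflection in \<open>g\<close> through the word letter by letter, replacing
  \<open>g\<close> by its mirror image. If \<open>g\<close> never turned negative, it would have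
  both signs at \<open>p\<close> once the word is exhausted. When it does turn negative,
  \<open>apos_reflect_wall\<close> identifies it with the current letter and the two reflections
  cancel.\<close>

lemma word_exchange:
  assumes p: "p \<in> C" and fs: "set fs \<subseteq> walls"
    and g: "g \<in> aroots" "ev g p > 0" "ev g (refl_word fs p) < 0"
  shows "\<exists>gs. set gs \<subseteq> walls \<and> length gs < length fs \<and> affine_refl g \<circ> refl_word fs = refl_word gs"
  using fs g
proof (induction fs arbitrary: g)
  case (Cons h fs)
  let ?g = "reflect_root h g"
  have h: "h \<in> walls" "h \<in> aroots" using Cons walls_aroots by auto
  have g': "?g \<in> aroots" using reflect_root_aroots h Cons by blast
  have word: "affine_refl g \<circ> refl_word (h # fs) = affine_refl h \<circ> (affine_refl ?g \<circ> refl_word fs)"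
    using affine_refl_conj[OF Cons(3) h(2)] by (simp add: comp_assoc[symmetric])
  show ?case
  proof (cases "apos ?g")
    case True
    then have "ev ?g p > 0" using ev_pos_iff g' p by blast
    moreover have "ev ?g (refl_word fs p) < 0"
      using Cons(5) ev_affine_refl[OF Cons(3) h(2)] by simp
    moreover have "set fs \<subseteq> walls" using Cons(2) by simp
    ultimately obtain gs where gs: "set gs \<subseteq> walls" "length gs < length fs"
        "affine_refl ?g \<circ> refl_word fs = refl_word gs"
      using Cons.IH[OF _ g'] by blast
    have "affine_refl g \<circ> refl_word (h # fs) = refl_word (h # gs)"
      unfolding word gs(3) by (rule refl_word_Cons[symmetric])
    moreover have "set (h # gs) \<subseteq> walls" "length (h # gs) < length (h # fs)" using gs h by simp_all
    ultimately show ?thesis by blast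
  next
    case False
    then have "g = h" using apos_reflect_wall[OF h(1) Cons(3)] ev_pos_iff Cons p by blast
    then have "affine_refl g \<circ> refl_word (h # fs) = refl_word fs"
      using affine_refl_refl[OF h(2)] by (auto simp: fun_eq_iff)
    moreover have "set fs \<subseteq> walls" "length fs < length (h # fs)" using Cons(2) by simp_all
    ultimately show ?thesis by blast
  qed
qed simp

text \<open>The first letter is negative at the image of \<open>p\<close> under the rest of the
  word, so the exchange argument rewrites the whole word as a strictly shorter one.\<close>

lemma word_free:
  assumes p: "p \<in> C" and fs: "set fs \<subseteq> walls" and stays: "refl_word fs p \<in> C"
  shows "refl_word fs = id"
  using fs stays
proof (induction "length fs" arbitrary: fs rule: less_induct)
  case less
  show ?case
  proof (cases fs)
    case (Cons h gs)
    then have h: "h \<in> walls" "h \<in> aroots" using less walls_aroots by auto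
    have "ev h (refl_word fs p) > 0" using less(3) h alcove_iff by blast
    then have "ev h (refl_word gs p) < 0" using ev_affine_refl_self[OF h(2)] Cons by simp
    moreover have "ev h p > 0" using p h alcove_iff by blast
    moreover have "set gs \<subseteq> walls" using less(2) Cons by simp
    ultimately obtain hs where hs: "set hs \<subseteq> walls" "length hs < length gs"
        "affine_refl h \<circ> refl_word gs = refl_word hs"
      using word_exchange[OF p _ h(2)] by blast
    moreover have fs: "refl_word fs = refl_word hs" using hs(3) Cons by simp
    ultimately show ?thesis using less(1)[of hs] less(3) Cons by simp
  qed simp
qed

section \<open>Every affine reflection is a word in wall reflections\<close>

lemma ht_highest_pos: "ht \<theta> \<ge> 1"
proof -
  obtain a where a: "a \<in> D" using D_nonempty by blast
  have "ht a \<le> ht \<theta>"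
    using ht_nonneg[OF highest_root(2)[OF D_root[OF a]]] by (simp add: ht_diff)
  then show ?thesis using ht_simple[OF a] by simp
qed

lemma aht_eq: "aht f = ht (fst f) + of_int (snd f) * (ht \<theta> + 1)"
  by (simp add: aht_def ht_def inner_add_left sum.distrib sum_distrib_left algebra_simps)

lemma aht_nonneg: "apos f \<Longrightarrow> aht f \<ge> 0"
  unfolding aht_def apos_def using ht_nonneg by auto

lemma aht_reflect_wall:
  assumes h: "h \<in> walls" and f: "f \<in> aroots"
  shows "aht (reflect_root h f) = aht f - fst f \<bullet> coroot (fst h)"
  using h
proof (cases rule: wallE)
  case (1 a)
  then show ?thesis by (simp add: aht_eq reflect_root_def ht_refl_simple)
next
  case 2
  obtain m where m: "fst f \<bullet> coroot \<theta> = of_int m"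
    using coroot_int[OF highest_root(1)] f by (auto simp: aroots_iff elim: Ints_cases)
  have "ht (- \<theta>) = - ht \<theta>" using ht_scale[of "-1" \<theta>] by simp
  with 2 show ?thesis
    by (simp add: aht_eq reflect_root_def refl_def coroot_minus m ht_diff ht_scale algebra_simps)
qed

text \<open>Affine counterpart of the descent for positive roots: \<open>a\<close> is a nonnegative
  combination of the gradients of the walls, so if it paired nonpositively with all of them,
  \<open>a \<bullet> a\<close> would be nonpositive.\<close>

lemma apos_descent:
  assumes f: "f \<in> aroots" "apos f"
  obtains h where "h \<in> walls" "fst f \<bullet> coroot (fst h) \<ge> 1"
proof -
  obtain a k where fak: "f = (a, k)" by (cases f)
  have a: "a \<in> R" and k: "k \<ge> 0" and nn: "nonneg (a + of_int k *\<^sub>R \<theta>)"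
    using f by (auto simp: fak aroots_iff apos_def)
  have "\<exists>h\<in>walls. a \<bullet> fst h > 0"
  proof (rule ccontr)
    assume "\<not> ?thesis"
    then have le: "a \<bullet> fst h \<le> 0" if "h \<in> walls" for h using that by force
    have "a \<bullet> a = (a + of_int k *\<^sub>R \<theta>) \<bullet> a + of_int k * (a \<bullet> (- \<theta>))"
      by (simp add: inner_add_left inner_add_right inner_commute)
    also have "(a + of_int k *\<^sub>R \<theta>) \<bullet> a = (\<Sum>b\<in>D. ((a + of_int k *\<^sub>R \<theta>) \<bullet> cw b) * (b \<bullet> a))"
      by (rule inner_simple_expansion)
    also have "\<dots> \<le> 0"
      using nn le[OF simple_wall]
      by (intro sum_nonpos mult_nonneg_nonpos) (auto simp: nonneg_def inner_commute)
    also have "of_int k * (a \<bullet> (- \<theta>)) \<le> 0"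
      using k le[OF highest_wall] by (intro mult_nonneg_nonpos) auto
    finally show False using root_nonzero[OF a] inner_gt_zero_iff[of a] by linarith
  qed
  then obtain h where h: "h \<in> walls" "a \<bullet> fst h > 0" by blast
  have "fst h \<in> R" using walls_aroots[OF h(1)] by (simp add: aroots_iff)
  then have "a \<bullet> coroot (fst h) \<ge> 1"
    using Ints_pos_ge_one coroot_int coroot_inner_pos_iff a h by blast
  then show ?thesis using that[of h] h fak by simp
qed

text \<open>Conjugating by the reflection in a descending wall replaces \<open>f\<close> by an
  affine root of smaller affine height, which stays positive as long as \<open>f\<close> is not
  itself a wall.\<close>

lemma affine_refl_word_apos:
  assumes "f \<in> aroots" "apos f"
  shows "\<exists>fs. set fs \<subseteq> walls \<and> refl_word fs = affine_refl f"
  using assms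
proof (induction "nat \<lfloor>aht f\<rfloor>" arbitrary: f rule: less_induct)
  case less
  show ?case
  proof (cases "f \<in> walls")
    case True
    then show ?thesis by (intro exI[of _ "[f]"]) simp
  next
    case False
    obtain h where h: "h \<in> walls" "fst f \<bullet> coroot (fst h) \<ge> 1"
      using apos_descent less by blast
    let ?f = "reflect_root h f"
    have h': "h \<in> aroots" using h walls_aroots by blast
    have f': "?f \<in> aroots" using reflect_root_aroots h' less by blast
    have ap: "apos ?f" using apos_reflect_wall[OF h(1) less(2,3)] False h by blast
    have "aht ?f \<ge> 0" "aht ?f + 1 \<le> aht f"
      using aht_nonneg[OF ap] aht_reflect_wall[OF h(1) less(2)] h by auto
    then have "nat \<lfloor>aht ?f\<rfloor> < nat \<lfloor>aht f\<rfloor>" by linarith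
    then obtain fs where fs: "set fs \<subseteq> walls" "refl_word fs = affine_refl ?f"
      using less(1) f' ap by blast
    have "affine_refl f = affine_refl h \<circ> affine_refl ?f \<circ> affine_refl h"
    proof
      fix v
      have "(affine_refl f \<circ> affine_refl h) (affine_refl h v) = (affine_refl h \<circ> affine_refl ?f) (affine_refl h v)"
        by (simp only: affine_refl_conj[OF less(2) h'])
      then show "affine_refl f v = (affine_refl h \<circ> affine_refl ?f \<circ> affine_refl h) v"
        by (simp add: affine_refl_refl[OF h'])
    qed
    also have "\<dots> = refl_word (h # fs @ [h])"
      by (simp only: refl_word_append refl_word_Cons refl_word_Nil comp_id fs(2) comp_assoc)
    finally have "refl_word (h # fs @ [h]) = affine_refl f" ..
    moreover have "set (h # fs @ [h]) \<subseteq> walls" using h fs by simp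
    ultimately show ?thesis by blast
  qed
qed

lemma affine_refl_word:
  assumes "f \<in> aroots"
  shows "\<exists>fs. set fs \<subseteq> walls \<and> refl_word fs = affine_refl f"
  using apos_cases[OF assms] affine_refl_word_apos assms aroots_uminus affine_refl_uminus by metis

section \<open>The affine Weyl group and its free action\<close>

definition waff :: "(real^'n \<Rightarrow> real^'n) set" where
  "waff = {refl_word fs |fs. set fs \<subseteq> walls}"

lemma waff_comp: "f \<in> waff \<Longrightarrow> g \<in> waff \<Longrightarrow> f \<circ> g \<in> waff"
  unfolding waff_def using refl_word_append by (smt (verit) Un_least mem_Collect_eq set_append)

lemma waff_affine_refl: "a \<in> R \<Longrightarrow> affine_refl (a, k) \<in> waff"
  using affine_refl_word[of "(a, k)"] unfolding waff_def by (auto simp: aroots_iff) metis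

lemma waff_weyl: "w \<in> W \<Longrightarrow> w \<in> waff"
proof (induction rule: weyl_group.induct)
  case weyl_id
  then show ?case unfolding waff_def by (auto intro!: exI[of _ "[]"])
next
  case (weyl_refl a w)
  then have "refl a \<in> waff" using waff_affine_refl[of a 0] by (simp add: affine_refl_zero)
  then show ?case using weyl_refl by (intro waff_comp)
qed

text \<open>Translation by \<open>coroot a\<close> is the product of the reflections in the parallel
  hyperplanes \<open>a \<bullet> v = 0\<close> and \<open>a \<bullet> v = 1\<close>.\<close>

lemma waff_transl: "q \<in> corootlat R \<Longrightarrow> (\<lambda>v. q + v) \<in> waff"
proof (induction rule: corootlat_induct)
  case zero
  then show ?case using waff_weyl[OF id_W] by (simp add: id_def)
next
  case (step a q)
  have "(\<lambda>v. coroot a + q + v) = affine_refl (- a, 1) \<circ> affine_refl (- a, 0) \<circ> (\<lambda>v. q + v)"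
    by (auto simp: fun_eq_iff affine_refl_eq coroot_minus)
  also have "\<dots> \<in> waff" using step waff_comp waff_affine_refl by simp
  finally show ?case .
qed

lemma waff_affine: "q \<in> corootlat R \<Longrightarrow> w \<in> W \<Longrightarrow> (\<lambda>v. q + w v) \<in> waff"
  using waff_comp[OF waff_transl waff_weyl] by (simp add: comp_def)

lemma refl_word_affine:
  "set fs \<subseteq> aroots \<Longrightarrow> \<exists>w\<in>W. \<exists>q\<in>corootlat R. \<forall>v. refl_word fs v = q + w v"
proof (induction fs)
  case Nil
  show ?case by (rule bexI[OF _ id_W], rule bexI[OF _ corootlat_zero]) simp
next
  case (Cons f fs)
  then obtain w q where w: "w \<in> W" and q: "q \<in> corootlat R" and *: "\<And>v. refl_word fs v = q + w v"
    by auto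
  obtain a k where f: "f = (a, k)" and a: "a \<in> R" using Cons by (cases f) (auto simp: aroots_iff)
  have "refl_word (f # fs) v = (refl a q - of_int k *\<^sub>R coroot a) + (refl a \<circ> w) v" for v
    by (simp add: * f affine_refl_eq linear_add[OF linear_refl])
  moreover have "refl a q - of_int k *\<^sub>R coroot a \<in> corootlat R"
    by (rule corootlat_diff[OF corootlat_weyl[OF q refl_in_weyl[OF a]] corootlat_scale[OF corootlat_coroot[OF a]]])
  moreover have "refl a \<circ> w \<in> W" using a w weyl_group.weyl_refl by blast
  ultimately show ?case by blast
qed

lemma affine_weyl_free:
  assumes "w \<in> W" "q \<in> corootlat R" "p \<in> C" "q + w p \<in> C"
  shows "w = id" and "q = 0"
proof -
  obtain fs where fs: "set fs \<subseteq> walls" "(\<lambda>v. q + w v) = refl_word fs"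
    using waff_affine assms unfolding waff_def by blast
  then have "refl_word fs = id"
    using word_free[OF assms(3)] assms(4) by metis
  then have e: "q + w v = v" for v using fs(2) by (metis id_apply)
  from e[of 0] show "q = 0" using weyl_zero[OF assms(1)] by simp
  then show "w = id" using e by auto
qed

section \<open>Transitivity on regular points\<close>

definition regular_point :: "real^'n \<Rightarrow> bool" where
  "regular_point v \<longleftrightarrow> (\<forall>a\<in>R. a \<bullet> v \<notin> \<int>)"

lemma regular_ev: "regular_point v \<Longrightarrow> f \<in> aroots \<Longrightarrow> ev f v \<notin> \<int>"
  using Ints_diff[of "ev f v" "of_int (snd f)"] by (auto simp: regular_point_def aroots_iff ev_def)

lemma regular_point_affine_refl:
  assumes v: "regular_point v" and h: "h \<in> aroots"
  shows "regular_point (affine_refl h v)"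
  unfolding regular_point_def
proof
  fix a assume "a \<in> R"
  then have f: "(a, 0) \<in> aroots" by (simp add: aroots_iff)
  have "a \<bullet> affine_refl h v = ev (reflect_root h (a, 0)) v"
    using ev_affine_refl[OF f h] by (simp add: ev_def)
  then show "a \<bullet> affine_refl h v \<notin> \<int>"
    using regular_ev[OF v reflect_root_aroots[OF h f]] by simp
qed

lemma alcove_regular:
  assumes "p \<in> C"
  shows "regular_point p"
  unfolding regular_point_def
proof (intro ballI notI)
  fix a assume a: "a \<in> R" and "a \<bullet> p \<in> \<int>"
  then obtain m where "a \<bullet> p = of_int m" by (auto elim: Ints_cases)
  then have "ev (a, - m) p = 0" by (simp add: ev_def)
  moreover have "(a, - m) \<in> aroots" using a by (simp add: aroots_iff)
  ultimately show False using ev_pos_iff ev_neg_iff assms by (metis less_irrefl)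
qed

text \<open>The hyperplanes between \<open>p\<close> and \<open>v\<close>, each represented by its
  affine root that is positive at \<open>p\<close>; their number measures the distance of
  \<open>v\<close> from the alcove.\<close>

definition separating :: "real^'n \<Rightarrow> real^'n \<Rightarrow> ((real^'n) \<times> int) set" where
  "separating p v = {f\<in>aroots. ev f p > 0 \<and> ev f v < 0}"

lemma finite_separating: "finite (separating p v)"
proof (rule finite_subset)
  show "separating p v \<subseteq> (SIGMA a:R. {\<lfloor>- (a \<bullet> p)\<rfloor>..\<lceil>- (a \<bullet> v)\<rceil>})"
  proof
    fix f assume f: "f \<in> separating p v"
    obtain a k where fak: "f = (a, k)" by (cases f)
    have "a \<in> R" "a \<bullet> p + of_int k > 0" "a \<bullet> v + of_int k < 0"
      using f by (auto simp: separating_def fak aroots_iff ev_def)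
    moreover from this have "\<lfloor>- (a \<bullet> p)\<rfloor> \<le> k" "k \<le> \<lceil>- (a \<bullet> v)\<rceil>" by linarith+
    ultimately show "f \<in> (SIGMA a:R. {\<lfloor>- (a \<bullet> p)\<rfloor>..\<lceil>- (a \<bullet> v)\<rceil>})" by (simp add: fak)
  qed
qed auto

lemma reflect_root_invol:
  assumes "f \<in> aroots" "h \<in> aroots"
  shows "reflect_root h (reflect_root h f) = f"
proof -
  have "refl (fst h) (fst f) \<bullet> coroot (fst h) = - (fst f \<bullet> coroot (fst h))"
    using assms(2) by (simp add: refl_def inner_diff_left coroot_self aroots_iff root_nonzero)
  then have "\<lfloor>refl (fst h) (fst f) \<bullet> coroot (fst h)\<rfloor> = - \<lfloor>fst f \<bullet> coroot (fst h)\<rfloor>"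
    using aroot_floor[OF assms] by (metis floor_of_int of_int_minus)
  then show ?thesis by (simp add: reflect_root_def prod_eq_iff)
qed

text \<open>\<open>reflect_root h\<close> maps the affine roots separating \<open>p\<close> from the
  mirror image of \<open>v\<close> injectively into those separating \<open>p\<close> from
  \<open>v\<close>. It misses \<open>h\<close>, which does separate \<open>p\<close> from
  \<open>v\<close>.\<close>

lemma card_separating_less:
  assumes p: "p \<in> C" and h: "h \<in> walls" "ev h v < 0"
  shows "card (separating p (affine_refl h v)) < card (separating p v)"
proof -
  have h': "h \<in> aroots" using h walls_aroots by blast
  let ?S = "separating p (affine_refl h v)"
  have "inj_on (reflect_root h) ?S"
    by (rule inj_on_inverseI[where g = "reflect_root h"])
       (use reflect_root_invol h' in \<open>auto simp: separating_def\<close>)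
  then have "card ?S = card (reflect_root h ` ?S)" by (simp add: card_image)
  also have "\<dots> < card (separating p v)"
  proof (rule psubset_card_mono[OF finite_separating])
    have in_diff: "reflect_root h f \<in> separating p v - {h}" if f: "f \<in> ?S" for f
    proof -
      have fa: "f \<in> aroots" "ev f p > 0" "ev f (affine_refl h v) < 0"
        using f by (auto simp: separating_def)
      have g: "reflect_root h f \<in> aroots" using reflect_root_aroots h' fa by blast
      have "f \<noteq> h" using fa ev_affine_refl_self[OF h', of v] h by auto
      then have "apos (reflect_root h f)"
        using apos_reflect_wall[OF h(1) fa(1)] ev_pos_iff[OF fa(1) p] fa by blast
      then have "ev (reflect_root h f) p > 0" using ev_pos_iff[OF g p] by blast
      moreover have "ev (reflect_root h f) v < 0" using fa ev_affine_refl[OF fa(1) h'] by simp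
      moreover have "reflect_root h f \<noteq> h"
      proof
        assume "reflect_root h f = h"
        then have "f = reflect_root h h" using reflect_root_invol[OF fa(1) h'] by simp
        then have "ev f p = - ev h p"
          using ev_affine_refl[OF h' h', of p] ev_affine_refl_self[OF h', of p] by simp
        moreover have "ev h p > 0" using p h alcove_iff by blast
        ultimately show False using fa by simp
      qed
      ultimately show ?thesis using g by (simp add: separating_def)
    qed
    have "h \<in> separating p v" using h h' p alcove_iff by (auto simp: separating_def)
    moreover have "reflect_root h ` ?S \<subseteq> separating p v - {h}"
      by (rule image_subsetI) (rule in_diff)
    ultimately show "reflect_root h ` ?S \<subset> separating p v"
      by (metis Diff_iff Diff_subset insertI1 psubsetI subset_trans subsetD)
  qed
  finally show ?thesis .
qed

text \<open>The vector usually written rho^v: pairing with it gives the height.\<close>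

definition rho :: "real^'n" where
  "rho = (\<Sum>a\<in>D. cw a)"

lemma inner_rho: "v \<bullet> rho = ht v"
  by (simp add: rho_def ht_def inner_sum_right)

text \<open>The denominator is the Coxeter number h. With it every wall of C, including
  \<open>(- \<theta>, 1)\<close>, takes the same value 1/h at this point.\<close>

definition center_pt :: "real^'n" where
  "center_pt = (1 / (ht \<theta> + 1)) *\<^sub>R rho"

lemma inner_center_pt: "v \<bullet> center_pt = ht v / (ht \<theta> + 1)"
  by (simp add: center_pt_def inner_rho)

lemma center_pt_alcove: "center_pt \<in> C"
  using ht_highest_pos by (simp add: alcove_def inner_center_pt ht_simple)

text \<open>Reflecting in a wall that is negative at \<open>v\<close> reduces the number of
  separating affine roots; regularity persists, so \<open>v\<close> never lies on a wall.\<close>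

lemma affine_weyl_transitive:
  assumes "regular_point v"
  shows "\<exists>w\<in>W. \<exists>q\<in>corootlat R. q + w v \<in> C"
proof -
  have "\<exists>fs. set fs \<subseteq> walls \<and> refl_word fs v \<in> C"
    using assms
  proof (induction "card (separating center_pt v)" arbitrary: v rule: less_induct)
    case less
    show ?case
    proof (cases "v \<in> C")
      case True
      then show ?thesis by (intro exI[of _ "[]"]) simp
    next
      case False
      then obtain h where h: "h \<in> walls" "ev h v \<le> 0" using alcove_iff by force
      have "ev h v \<noteq> 0" using regular_ev[OF less(2) walls_aroots[OF h(1)]] by auto
      then have "ev h v < 0" using h by simp
      then obtain fs where "set fs \<subseteq> walls" "refl_word fs (affine_refl h v) \<in> C"
        using less(1)[OF card_separating_less[OF center_pt_alcove h(1)]]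
          regular_point_affine_refl[OF less(2) walls_aroots[OF h(1)]] by blast
      then show ?thesis using h
        by (intro exI[of _ "fs @ [h]"]) (simp add: refl_word_append)
    qed
  qed
  then obtain fs where fs: "set fs \<subseteq> walls" "refl_word fs v \<in> C" by blast
  then have "set fs \<subseteq> aroots" using walls_aroots by blast
  then obtain w q where "w \<in> W" "q \<in> corootlat R" "\<forall>v. refl_word fs v = q + w v"
    using refl_word_affine by blast
  then show ?thesis using fs by metis
qed

section \<open>The extended affine Weyl group and \<open>psi\<close>\<close>

lemma ev_extended:
  assumes "w \<in> W" "\<nu> \<in> cowlat R" "f \<in> aroots"
  obtains g where "g \<in> aroots" "\<And>v. ev f (\<nu> + w v) = ev g v"
proof
  let ?g = "(inv w (fst f), snd f + \<lfloor>fst f \<bullet> \<nu>\<rfloor>)"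
  have "fst f \<in> R" using assms by (simp add: aroots_iff)
  then show "?g \<in> aroots" using weyl_root[OF weyl_inv] assms by (simp add: aroots_iff)
  obtain m where "fst f \<bullet> \<nu> = of_int m"
    using cowlat_int[OF assms(2) \<open>fst f \<in> R\<close>] by (elim Ints_cases)
  then show "ev f (\<nu> + w v) = ev ?g v" for v
    by (simp add: ev_def inner_add_right weyl_inner_inv[OF assms(1)])
qed

text \<open>The pullback of a wall is an affine root, and its sign on C is decided at the single
  point \<open>p\<close>.\<close>

lemma extended_alcove:
  assumes w: "w \<in> W" "\<nu> \<in> cowlat R" and p: "p \<in> C" "\<nu> + w p \<in> C" and v: "v \<in> C"
  shows "\<nu> + w v \<in> C"
  unfolding alcove_iff
proof
  fix h assume h: "h \<in> walls"
  obtain g where g: "g \<in> aroots" "\<And>v. ev h (\<nu> + w v) = ev g v"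
    using ev_extended[OF w walls_aroots[OF h]] by blast
  have "ev g p > 0" using p(2) h g alcove_iff by metis
  then show "ev h (\<nu> + w v) > 0" using g ev_pos_iff p(1) v by metis
qed

lemma extended_inverse:
  assumes w: "w \<in> W" "\<nu> \<in> cowlat R"
  shows "inv w \<in> W" "- inv w \<nu> \<in> cowlat R" "- inv w \<nu> + inv w (\<nu> + w v) = v"
    "\<nu> + w (- inv w \<nu> + inv w v) = v"
proof -
  show i: "inv w \<in> W" using w weyl_inv by blast
  show "- inv w \<nu> \<in> cowlat R" using w i cowlat_minus cowlat_weyl by blast
  show "- inv w \<nu> + inv w (\<nu> + w v) = v" using w i by (simp add: weyl_add)
  show "\<nu> + w (- inv w \<nu> + inv w v) = v"
    using w weyl_diff[OF w(1), of "inv w v" "inv w \<nu>"] by simp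
qed

lemma extended_alcove_inv:
  assumes w: "w \<in> W" "\<nu> \<in> cowlat R" and p: "p \<in> C" "\<nu> + w p \<in> C" and v: "v \<in> C"
  shows "- inv w \<nu> + inv w v \<in> C"
  using extended_alcove[OF extended_inverse(1,2)[OF w], of "\<nu> + w p"] extended_inverse(3)[OF w] p v
  by simp

lemma extended_alcove_image:
  assumes w: "w \<in> W" "\<nu> \<in> cowlat R" and p: "p \<in> C" "\<nu> + w p \<in> C"
  shows "(\<lambda>v. \<nu> + w v) ` C = C"
proof
  show "(\<lambda>v. \<nu> + w v) ` C \<subseteq> C" using extended_alcove[OF assms] by blast
  show "C \<subseteq> (\<lambda>v. \<nu> + w v) ` C"
  proof
    fix v assume "v \<in> C"
    then show "v \<in> (\<lambda>v. \<nu> + w v) ` C"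
      using extended_alcove_inv[OF assms] extended_inverse(4)[OF w, of v]
      by (intro image_eqI[where x = "- inv w \<nu> + inv w v"]) simp_all
  qed
qed

text \<open>Composing one map with the inverse of the other gives an element of the affine Weyl
  group that sends a point of C into C; freeness makes it the identity.\<close>

lemma extended_unique:
  assumes w: "w \<in> W" "\<nu> \<in> cowlat R" and p: "p \<in> C" "\<nu> + w p \<in> C"
    and w': "w' \<in> W" "\<nu>' \<in> cowlat R" and p': "p' \<in> C" "\<nu>' + w' p' \<in> C"
    and q: "\<nu> - \<nu>' \<in> corootlat R"
  shows "w = w'"
proof -
  have "- inv w' \<nu>' + inv w' (\<nu> + w p) \<in> C"
    using extended_alcove_inv[OF w' p' p(2)] .
  then have *: "inv w' (\<nu> - \<nu>') + (inv w' \<circ> w) p \<in> C"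
    using weyl_inv[OF w'(1)] by (simp add: weyl_add weyl_diff algebra_simps)
  have "inv w' \<circ> w = id"
    by (rule affine_weyl_free(1)[where q = "inv w' (\<nu> - \<nu>')" and w = "inv w' \<circ> w", OF _ _ p(1) *])
       (rule weyl_comp[OF weyl_inv[OF w'(1)] w(1)], rule corootlat_weyl[OF q weyl_inv[OF w'(1)]])
  then show ?thesis using weyl_inv_right[OF w'(1)] by (metis comp_apply ext id_apply)
qed

text \<open>Move \<open>mu + center_pt\<close> back into C by v -> q + w v. The composite has
  translation part \<open>q + w mu\<close>, which is congruent to \<open>mu\<close> modulo
  coroots.\<close>

lemma extended_exists:
  assumes mu: "mu \<in> cowlat R"
  obtains w \<nu> where "w \<in> W" "\<nu> \<in> cowlat R" "\<nu> - mu \<in> corootlat R" "\<nu> + w center_pt \<in> C"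
proof -
  have "regular_point (mu + center_pt)"
    unfolding regular_point_def
  proof (intro ballI notI)
    fix a assume a: "a \<in> R" "a \<bullet> (mu + center_pt) \<in> \<int>"
    then have "a \<bullet> (mu + center_pt) - a \<bullet> mu \<in> \<int>" using cowlat_int[OF mu] by (intro Ints_diff) auto
    then show False using alcove_regular[OF center_pt_alcove] a
      by (simp add: regular_point_def inner_add_right)
  qed
  then obtain w q where w: "w \<in> W" and q: "q \<in> corootlat R" and c: "q + w (mu + center_pt) \<in> C"
    using affine_weyl_transitive by blast
  have d: "(q + w mu) - mu \<in> corootlat R"
    using corootlat_add[OF q weyl_diff_corootlat[OF w mu]] by (simp add: add_diff_eq)
  show ?thesis
    by (rule that[OF w _ d])
       (use c w q mu in \<open>auto simp: weyl_add add.assoc cowlat_add corootlat_cowlat cowlat_weyl\<close>)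
qed

text \<open>Replaces the condition on the whole alcove in \<open>psi\<close> by a test at one
  point.\<close>

lemma psi_eq:
  assumes "mu \<in> cowlat R" "w \<in> W" "\<nu> \<in> cowlat R" "\<nu> - mu \<in> corootlat R" "p \<in> C" "\<nu> + w p \<in> C"
  shows "psi R D mu = w"
  unfolding psi_def
proof (rule the_equality)
  show "w \<in> W \<and> (\<exists>nu\<in>cowlat R. nu - mu \<in> corootlat R \<and> (\<lambda>v. nu + w v) ` C = C)"
    using assms extended_alcove_image by blast
  fix w' assume "w' \<in> W \<and> (\<exists>nu\<in>cowlat R. nu - mu \<in> corootlat R \<and> (\<lambda>v. nu + w' v) ` C = C)"
  then obtain \<nu>' where w': "w' \<in> W" "\<nu>' \<in> cowlat R" "\<nu>' - mu \<in> corootlat R" "(\<lambda>v. \<nu>' + w' v) ` C = C"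
    by blast
  have "\<nu>' + w' p \<in> C" using w'(4) assms(5) by blast
  moreover have "\<nu>' - \<nu> \<in> corootlat R" using corootlat_diff[OF w'(3) assms(4)] by simp
  ultimately show "w' = w"
    using extended_unique w' assms by blast
qed

text \<open>The value of an affine root at \<open>center_pt\<close> is its affine height divided by
  h. At the image point each wall is therefore a positive integer multiple of 1/h, hence at least
  1/h. Weighted by the coordinates of \<theta>, and by 1 for the highest wall, the walls add up to
  the constant 1, and the weights add up to h; so every wall equals 1/h.\<close>

lemma extended_fixes_center_pt:
  assumes w: "w \<in> W" "\<nu> \<in> cowlat R" and p: "p \<in> C" "\<nu> + w p \<in> C"
  shows "\<nu> + w center_pt = center_pt"
proof -
  let ?H = "ht \<theta> + 1" and ?p = "\<nu> + w center_pt"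
  have H: "?H > 0" using ht_highest_pos by simp
  have ev_c: "ev f center_pt = aht f / ?H" for f
    using H by (simp add: ev_def inner_center_pt aht_eq field_simps)
  have ge: "ev h ?p \<ge> 1 / ?H" if h: "h \<in> walls" for h
  proof -
    obtain g where g: "g \<in> aroots" "\<And>v. ev h (\<nu> + w v) = ev g v"
      using ev_extended[OF w walls_aroots[OF h]] by blast
    have "ev g center_pt > 0"
      using extended_alcove[OF w p center_pt_alcove] h g alcove_iff by metis
    then have "aht g > 0" using H by (simp add: ev_c zero_less_divide_iff)
    moreover have "aht g \<in> \<int>"
      using g(1) highest_root(1) by (auto simp: aht_eq aroots_iff intro!: Ints_add Ints_mult ht_int)
    ultimately have "aht g \<ge> 1" by (rule Ints_pos_ge_one[rotated])
    then show ?thesis using g ev_c H by (simp add: divide_right_mono)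
  qed
  have ge_simple: "a \<bullet> ?p - 1 / ?H \<ge> 0" if "a \<in> D" for a
    using ge[OF simple_wall[OF that]] by (simp add: ev_def)
  have "\<theta> \<bullet> ?p \<le> 1 - 1 / ?H" using ge[OF highest_wall] by (simp add: ev_def)
  also have "1 - 1 / ?H = ht \<theta> / ?H" using H by (simp add: field_simps)
  also have "\<dots> = (\<Sum>a\<in>D. (\<theta> \<bullet> cw a) * (1 / ?H))"
    by (simp add: ht_def sum_divide_distrib)
  also have "\<theta> \<bullet> ?p = (\<Sum>a\<in>D. (\<theta> \<bullet> cw a) * (a \<bullet> ?p))" by (rule inner_simple_expansion)
  finally have le: "(\<Sum>a\<in>D. (\<theta> \<bullet> cw a) * (a \<bullet> ?p - 1 / ?H)) \<le> 0"
    by (simp add: right_diff_distrib sum_subtractf)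
  have nn: "(\<theta> \<bullet> cw a) * (a \<bullet> ?p - 1 / ?H) \<ge> 0" if "a \<in> D" for a
    using ge_simple[OF that] highest_root_inner_cw[OF that] by simp
  then have "\<forall>a\<in>D. (\<theta> \<bullet> cw a) * (a \<bullet> ?p - 1 / ?H) = 0"
    using le sum_nonneg[of D "\<lambda>a. (\<theta> \<bullet> cw a) * (a \<bullet> ?p - 1 / ?H)"]
    by (subst sum_nonneg_eq_0_iff[symmetric]) auto
  then have "a \<bullet> ?p = a \<bullet> center_pt" if "a \<in> D" for a
    using that highest_root_inner_cw[OF that] by (auto simp: inner_center_pt ht_simple)
  then show ?thesis by (rule eq_if_inner_simple_eq)
qed

end

subsection \<open>Torus elements with g(u) = xu\<close>

text \<open>The element exp(r + 2 pi i t) of A: \<open>r\<close> carries the modulus and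
  \<open>t\<close> the argument.\<close>

definition torus_char :: "real^'n \<Rightarrow> real^'n \<Rightarrow> real^'n \<Rightarrow> complex" where
  "torus_char r t l = exp (Complex (l \<bullet> r) (2 * pi * (l \<bullet> t)))"

lemma torus_char_add: "torus_char r t (l + m) = torus_char r t l * torus_char r t m"
  by (simp add: torus_char_def inner_add_left complex_add algebra_simps flip: exp_add)

lemma torus_char_mult: "torus_char r t l * torus_char r' t' l = torus_char (r + r') (t + t') l"
  by (simp add: torus_char_def inner_add_right complex_add algebra_simps flip: exp_add)

lemma torus_char_nonzero [simp]: "torus_char r t l \<noteq> 0"
  by (simp add: torus_char_def)

lemma torus_char_eq_1: "torus_char r t l = 1 \<longleftrightarrow> l \<bullet> r = 0 \<and> l \<bullet> t \<in> \<int>"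
  by (auto simp: torus_char_def exp_eq_1 algebra_simps elim!: Ints_cases)

context based_root_system
begin

section \<open>Fundamental weights and logarithms of torus elements\<close>

lemma eq_if_inner_coroot_eq:
  assumes "\<And>b. b \<in> D \<Longrightarrow> l \<bullet> coroot b = m \<bullet> coroot b"
  shows "l = m"
proof (rule eq_if_inner_simple_eq)
  fix b assume "b \<in> D"
  then show "b \<bullet> l = b \<bullet> m"
    using assms[of b] root_nonzero D_root by (simp add: inner_coroot inner_commute)
qed

abbreviation "\<omega> \<equiv> fund_weight D"

lemma fund_weight_coroot:
  assumes "a \<in> D" "b \<in> D"
  shows "\<omega> a \<bullet> coroot b = (if b = a then 1 else 0)"
proof -
  let ?P = "\<lambda>l. \<forall>b\<in>D. l \<bullet> coroot b = (if b = a then 1 else 0)"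
  let ?l = "((a \<bullet> a) / 2) *\<^sub>R cw a"
  have "?P ?l"
    using root_nonzero D_root assms(1)
    by (auto simp: inner_coroot inner_commute[of "cw a"] simple_inner_cw)
  moreover have "l = ?l" if "?P l" for l
    by (rule eq_if_inner_coroot_eq) (use that \<open>?P ?l\<close> in simp)
  ultimately have "?P (\<omega> a)" unfolding fund_weight_def by (rule theI)
  then show ?thesis using assms by blast
qed

lemma fund_weight_wlat: "a \<in> D \<Longrightarrow> \<omega> a \<in> wlat R"
  by (simp add: wlat_iff fund_weight_coroot)

lemma fund_weight_expansion: "l = (\<Sum>a\<in>D. (l \<bullet> coroot a) *\<^sub>R \<omega> a)"
proof (rule eq_if_inner_coroot_eq)
  fix b assume b: "b \<in> D"
  have "(\<Sum>a\<in>D. (l \<bullet> coroot a) *\<^sub>R \<omega> a) \<bullet> coroot b = (\<Sum>a\<in>D. if a = b then l \<bullet> coroot a else 0)"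
    unfolding inner_sum_left by (rule sum.cong) (use b in \<open>auto simp: fund_weight_coroot\<close>)
  then show "l \<bullet> coroot b = (\<Sum>a\<in>D. (l \<bullet> coroot a) *\<^sub>R \<omega> a) \<bullet> coroot b"
    using b by simp
qed

text \<open>P(R) and Q(R^v) are dual lattices, the coordinates of \<open>q\<close> in the simple
  coroots being its pairings with the fundamental weights. So equations between torus elements
  become congruences modulo coroots.\<close>

lemma corootlat_iff: "q \<in> corootlat R \<longleftrightarrow> (\<forall>l\<in>wlat R. l \<bullet> q \<in> \<int>)"
proof
  assume *: "\<forall>l\<in>wlat R. l \<bullet> q \<in> \<int>"
  have "q = (\<Sum>a\<in>D. of_int \<lfloor>\<omega> a \<bullet> q\<rfloor> *\<^sub>R coroot a)"
  proof -
    have *: "l \<bullet> q = l \<bullet> (\<Sum>a\<in>D. of_int \<lfloor>\<omega> a \<bullet> q\<rfloor> *\<^sub>R coroot a)" for l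
    proof -
      have "l \<bullet> q = (\<Sum>a\<in>D. (l \<bullet> coroot a) *\<^sub>R \<omega> a) \<bullet> q"
        using fund_weight_expansion[of l] by (rule arg_cong)
      also have "\<dots> = (\<Sum>a\<in>D. (l \<bullet> coroot a) * of_int \<lfloor>\<omega> a \<bullet> q\<rfloor>)"
        unfolding inner_sum_left
        by (rule sum.cong) (use * fund_weight_wlat in \<open>auto simp: of_int_floor_Ints simp del: of_int_floor_cancel\<close>)
      finally show ?thesis by (simp add: inner_sum_right mult.commute)
    qed
    show ?thesis by (rule eq_if_inner_simple_eq) (rule *)
  qed
  also have "\<dots> \<in> corootlat R"
    by (intro corootlat_sum corootlat_scale[OF corootlat_coroot] D_root)
  finally show "q \<in> corootlat R" .
qed (use corootlat_wlat_int in blast)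

lemma torus_nonzero: "u \<in> torus R \<Longrightarrow> l \<in> wlat R \<Longrightarrow> u l \<noteq> 0"
  and torus_add: "u \<in> torus R \<Longrightarrow> l \<in> wlat R \<Longrightarrow> m \<in> wlat R \<Longrightarrow> u (l + m) = u l * u m"
  by (auto simp: torus_def)

lemma torus_zero: "u \<in> torus R \<Longrightarrow> u 0 = 1"
  using torus_add[of u 0 0] torus_nonzero[of u 0] wlat_zero by simp

lemma torus_minus: "u \<in> torus R \<Longrightarrow> l \<in> wlat R \<Longrightarrow> u (- l) = inverse (u l)"
  using torus_add[of u l "- l"] torus_zero wlat_minus inverse_unique[of "u l" "u (- l)"] by force

lemma wlat_nat_scale: "l \<in> wlat R \<Longrightarrow> real n *\<^sub>R l \<in> wlat R"
  by (induction n) (auto simp: wlat_zero wlat_add algebra_simps)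

lemma torus_nat_scale: "u \<in> torus R \<Longrightarrow> l \<in> wlat R \<Longrightarrow> u (real n *\<^sub>R l) = u l ^ n"
  by (induction n) (auto simp: torus_zero torus_add wlat_nat_scale scaleR_add_left)

lemma wlat_int_scale: "l \<in> wlat R \<Longrightarrow> of_int n *\<^sub>R l \<in> wlat R"
  using wlat_nat_scale[of l "nat n"] wlat_minus[OF wlat_nat_scale[of l "nat (- n)"]]
  by (cases "n \<ge> 0") auto

lemma torus_int_scale: "u \<in> torus R \<Longrightarrow> l \<in> wlat R \<Longrightarrow> u (of_int n *\<^sub>R l) = u l powi n"
  using torus_nat_scale[of u l "nat n"] torus_nat_scale[of u l "nat (- n)"]
    torus_minus[OF _ wlat_nat_scale[of l "nat (- n)"], of u]
  by (cases "n \<ge> 0") (auto simp: power_int_def power_inverse)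

lemma torus_sum:
  assumes "u \<in> torus R" "\<And>i. i \<in> S \<Longrightarrow> f i \<in> wlat R" "finite S"
  shows "sum f S \<in> wlat R \<and> u (sum f S) = (\<Prod>i\<in>S. u (f i))"
  using assms(3,2)
  by (induction S rule: finite_induct) (use assms(1) in \<open>auto simp: wlat_zero torus_zero wlat_add torus_add\<close>)

lemma torus_expansion:
  assumes u: "u \<in> torus R" and l: "l \<in> wlat R"
  shows "u l = (\<Prod>a\<in>D. u (\<omega> a) powi \<lfloor>l \<bullet> coroot a\<rfloor>)"
proof -
  have "l = (\<Sum>a\<in>D. of_int \<lfloor>l \<bullet> coroot a\<rfloor> *\<^sub>R \<omega> a)"
    using wlat_int[OF l D_root] by (subst fund_weight_expansion[of l]) (simp add: of_int_floor_Ints del: of_int_floor_cancel)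
  then have "u l = u (\<Sum>a\<in>D. of_int \<lfloor>l \<bullet> coroot a\<rfloor> *\<^sub>R \<omega> a)" by (rule arg_cong)
  also have "\<dots> = (\<Prod>a\<in>D. u (of_int \<lfloor>l \<bullet> coroot a\<rfloor> *\<^sub>R \<omega> a))"
    using torus_sum[OF u _ finite_D, of "\<lambda>a. of_int \<lfloor>l \<bullet> coroot a\<rfloor> *\<^sub>R \<omega> a"] fund_weight_wlat wlat_int_scale
    by blast
  also have "\<dots> = (\<Prod>a\<in>D. u (\<omega> a) powi \<lfloor>l \<bullet> coroot a\<rfloor>)"
    by (rule prod.cong) (simp_all add: torus_int_scale u fund_weight_wlat)
  finally show ?thesis .
qed

lemma torus_char_torus: "torus_char r t \<in> torus R"
  by (simp add: torus_def torus_char_add)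

text \<open>P(R) is free on the fundamental weights, so any choice of logarithms there is
  consistent; the simple coroots, dual to these weights, assemble them into \<open>r\<close> and
  \<open>t\<close>.\<close>

lemma torus_lift:
  assumes u: "u \<in> torus R"
  obtains r t where "\<And>l. l \<in> wlat R \<Longrightarrow> u l = torus_char r t l"
proof -
  define z where "z a = Ln (u (\<omega> a))" for a
  define r where "r = (\<Sum>a\<in>D. Re (z a) *\<^sub>R coroot a)"
  define t where "t = (\<Sum>a\<in>D. (Im (z a) / (2 * pi)) *\<^sub>R coroot a)"
  have inner: "\<omega> a \<bullet> (\<Sum>b\<in>D. f b *\<^sub>R coroot b) = f a" if "a \<in> D" for a and f :: "real^'n \<Rightarrow> real"
  proof -
    have "\<omega> a \<bullet> (\<Sum>b\<in>D. f b *\<^sub>R coroot b) = (\<Sum>b\<in>D. if b = a then f b else 0)"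
      unfolding inner_sum_right by (rule sum.cong) (use that in \<open>auto simp: fund_weight_coroot\<close>)
    then show ?thesis using that by simp
  qed
  have "torus_char r t (\<omega> a) = u (\<omega> a)" if "a \<in> D" for a
  proof -
    have "torus_char r t (\<omega> a) = exp (z a)"
      using that by (simp add: torus_char_def r_def t_def inner)
    then show ?thesis using torus_nonzero[OF u fund_weight_wlat[OF that]] by (simp add: z_def)
  qed
  then have "u l = torus_char r t l" if "l \<in> wlat R" for l
    using torus_expansion[OF u that] torus_expansion[OF torus_char_torus that] by simp
  then show ?thesis using that by blast
qed

text \<open>Triviality on the roots, which span V, kills the modulus and makes the argument a
  coweight.\<close>

lemma center_lift:
  assumes x: "x \<in> center R"
  obtains \<eta> where "\<eta> \<in> cowlat R" "\<And>l. l \<in> wlat R \<Longrightarrow> x l = torus_char 0 \<eta> l"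
proof -
  have "x \<in> torus R" using x by (simp add: center_def)
  then obtain r t where rt: "\<And>l. l \<in> wlat R \<Longrightarrow> x l = torus_char r t l" using torus_lift by blast
  have *: "a \<bullet> r = 0 \<and> a \<bullet> t \<in> \<int>" if "a \<in> R" for a
    using rt[OF wlat_root[OF that]] x that torus_char_eq_1[of r t a] by (simp add: center_def)
  then have "r = 0" using eq_zero_if_orthogonal_roots by blast
  moreover have "t \<in> cowlat R" using * by (simp add: cowlat_def)
  ultimately show ?thesis using that rt by blast
qed

lemma torus_char_weyl: "w \<in> W \<Longrightarrow> torus_char r t (inv w l) = torus_char (w r) (w t) l"
  by (simp add: torus_char_def weyl_inner_inv)

text \<open>The modulus part r of u is fixed by g. Adding a generic real multiple of r to the
  argument t makes it a regular point of V without changing the equation g t = t + eta.\<close>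

lemma twisted_fix_regular_point:
  assumes g: "g \<in> W" and u: "u \<in> torus R" "regular R u" "twisted_fix R g x u"
    and x: "\<And>l. l \<in> wlat R \<Longrightarrow> x l = torus_char 0 \<eta> l"
  obtains t q where "regular_point t" "q \<in> corootlat R" "g t = t + \<eta> + q"
proof -
  obtain r t where rt: "\<And>l. l \<in> wlat R \<Longrightarrow> u l = torus_char r t l" using torus_lift u(1) by blast
  have "torus_char (g r - r) (g t - t - \<eta>) l = 1" if l: "l \<in> wlat R" for l
  proof -
    have "u (inv g l) = x l * u l" using u(3) l by (simp add: twisted_fix_def)
    then have "torus_char (g r) (g t) l = torus_char r (\<eta> + t) l"
      using rt[OF wlat_weyl[OF weyl_inv[OF g] l]] rt[OF l] x[OF l]
      by (simp add: torus_char_weyl[OF g] torus_char_mult)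
    moreover have "torus_char (g r - r) (g t - t - \<eta>) l * torus_char r (\<eta> + t) l = torus_char (g r) (g t) l"
      by (simp add: torus_char_mult)
    ultimately show ?thesis using torus_char_nonzero[of r "\<eta> + t" l]
      by (metis mult_cancel_right1 mult.commute)
  qed
  then have *: "l \<bullet> (g r - r) = 0 \<and> l \<bullet> (g t - t - \<eta>) \<in> \<int>" if "l \<in> wlat R" for l
    using that by (simp add: torus_char_eq_1)
  have "g r - r = 0"
    by (rule eq_zero_if_orthogonal_roots) (use * wlat_root in blast)
  then have gr: "g r = r" by simp
  define q where "q = g t - t - \<eta>"
  have q: "q \<in> corootlat R" using * by (simp add: corootlat_iff q_def)
  \<comment> \<open>A root with \<open>a \<bullet> r = 0\<close> excludes no \<open>e\<close>, since
    regularity of \<open>u\<close> then says that \<open>a \<bullet> t\<close> is not an integer;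
    any other root excludes one \<open>e\<close> for each integer.\<close>
  define bad where "bad a = {e::real. a \<bullet> (t + e *\<^sub>R r) \<in> \<int>}" for a
  have "countable (bad a)" if a: "a \<in> R" for a
  proof (cases "a \<bullet> r = 0")
    case True
    have "u a \<noteq> 1" using u(2) a by (simp add: regular_def)
    then have "bad a = {}"
      using rt[OF wlat_root[OF a]] True by (simp add: torus_char_eq_1 bad_def inner_add_right)
    then show ?thesis by simp
  next
    case False
    have "bad a \<subseteq> (\<lambda>m. (m - a \<bullet> t) / (a \<bullet> r)) ` \<int>"
    proof
      fix e assume "e \<in> bad a"
      then show "e \<in> (\<lambda>m. (m - a \<bullet> t) / (a \<bullet> r)) ` \<int>"
        using False by (intro image_eqI[where x = "a \<bullet> (t + e *\<^sub>R r)"])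
          (simp_all add: bad_def inner_add_right)
    qed
    moreover have "countable (\<int> :: real set)" unfolding Ints_def by simp
    ultimately show ?thesis by (rule countable_subset[OF _ countable_image])
  qed
  then have "countable (\<Union>a\<in>R. bad a)"
    by (rule countable_UN[OF countable_finite[OF finite_R]])
  then have "(\<Union>a\<in>R. bad a) \<noteq> UNIV" using uncountable_UNIV_real by metis
  then obtain e where "e \<notin> (\<Union>a\<in>R. bad a)" by blast
  then have "regular_point (t + e *\<^sub>R r)" by (auto simp: bad_def regular_point_def)
  moreover have "g (t + e *\<^sub>R r) = (t + e *\<^sub>R r) + \<eta> + q"
    by (simp add: weyl_add[OF g] weyl_scale[OF g] gr q_def)
  ultimately show ?thesis using that q by blast
qed

text \<open>If v -> q1 + w v brings the regular point t into C, then the conjugate of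
  \<open>g\<close> by \<open>w\<close> satisfies the same equation there up to coroots: replacing
  \<open>w \<eta>\<close> by \<open>\<eta>\<close>, and the conjugate applied to \<open>q1\<close>
  by \<open>q1\<close>, costs only coroots.\<close>

lemma twisted_fix_conj_alcove:
  assumes g: "g \<in> W" and u: "u \<in> torus R" "regular R u" "twisted_fix R g x u"
    and \<eta>: "\<eta> \<in> cowlat R" and x: "\<And>l. l \<in> wlat R \<Longrightarrow> x l = torus_char 0 \<eta> l"
  obtains h p q where "h \<in> W" "p \<in> C" "q \<in> corootlat R" "(h \<circ> g \<circ> inv h) p = p + \<eta> + q"
proof -
  obtain t q where t: "regular_point t" "q \<in> corootlat R" "g t = t + \<eta> + q"
    using twisted_fix_regular_point[OF g u x] by blast
  obtain w q1 where w: "w \<in> W" "q1 \<in> corootlat R" "q1 + w t \<in> C"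
    using affine_weyl_transitive[OF t(1)] by blast
  let ?k = "w \<circ> g \<circ> inv w" and ?p = "q1 + w t"
  have k: "?k \<in> W" using w(1) g weyl_comp weyl_inv by blast
  have "?k ?p = ?k q1 + w (g t)"
    using w(1) by (simp add: weyl_add[OF k, unfolded comp_apply])
  also have "\<dots> = ?p + \<eta> + ((w \<eta> - \<eta>) + w q + (?k q1 - q1))"
    using w(1) by (simp add: t(3) weyl_add)
  finally have eq: "?k ?p = ?p + \<eta> + ((w \<eta> - \<eta>) + w q + (?k q1 - q1))" .
  show ?thesis
    by (rule that[OF w(1) w(3) _ eq])
       (use corootlat_add[OF corootlat_add[OF weyl_diff_corootlat[OF w(1) \<eta>] corootlat_weyl[OF t(2) w(1)]]
          weyl_diff_corootlat[OF k corootlat_cowlat[OF w(2)]]] in simp)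
qed

lemma twisted_fix_conjugate:
  assumes x: "x \<in> center R"
    and g1: "g1 \<in> W" and u1: "u1 \<in> torus R" "regular R u1" "twisted_fix R g1 x u1"
    and g2: "g2 \<in> W" and u2: "u2 \<in> torus R" "regular R u2" "twisted_fix R g2 x u2"
  shows "\<exists>h\<in>W. g2 = h \<circ> g1 \<circ> inv h"
proof -
  obtain \<eta> where \<eta>: "\<eta> \<in> cowlat R" "\<And>l. l \<in> wlat R \<Longrightarrow> x l = torus_char 0 \<eta> l"
    using center_lift[OF x] by blast
  obtain h1 p1 q1 where 1: "h1 \<in> W" "p1 \<in> C" "q1 \<in> corootlat R" "(h1 \<circ> g1 \<circ> inv h1) p1 = p1 + \<eta> + q1"
    using twisted_fix_conj_alcove[OF g1 u1 \<eta>] by blast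
  obtain h2 p2 q2 where 2: "h2 \<in> W" "p2 \<in> C" "q2 \<in> corootlat R" "(h2 \<circ> g2 \<circ> inv h2) p2 = p2 + \<eta> + q2"
    using twisted_fix_conj_alcove[OF g2 u2 \<eta>] by blast
  have nu: "- \<eta> - q \<in> cowlat R" if "q \<in> corootlat R" for q
    using cowlat_add[OF cowlat_minus[OF \<eta>(1)] cowlat_minus[OF corootlat_cowlat[OF that]]] by simp
  \<comment> \<open>Each equation says that v -> - \<eta> - q + k v, with k the conjugate of g,
    fixes its point p of C; the two translation parts differ by a coroot lattice element.\<close>
  have "h1 \<circ> g1 \<circ> inv h1 = h2 \<circ> g2 \<circ> inv h2"
  proof (rule extended_unique[where \<nu> = "- \<eta> - q1" and \<nu>' = "- \<eta> - q2" and p = p1 and p' = p2])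
    show "h1 \<circ> g1 \<circ> inv h1 \<in> W" "h2 \<circ> g2 \<circ> inv h2 \<in> W"
      using 1(1) 2(1) g1 g2 weyl_comp weyl_inv by blast+
    show "- \<eta> - q1 - (- \<eta> - q2) \<in> corootlat R"
      using corootlat_diff[OF 2(3) 1(3)] by simp
    show "- \<eta> - q1 + (h1 \<circ> g1 \<circ> inv h1) p1 \<in> C" unfolding 1(4) using 1(2) by simp
    show "- \<eta> - q2 + (h2 \<circ> g2 \<circ> inv h2) p2 \<in> C" unfolding 2(4) using 2(2) by simp
  qed (use 1 2 nu in auto)
  then have e: "h1 (g1 (inv h1 v)) = h2 (g2 (inv h2 v))" for v by (metis comp_apply)
  define h where "h = inv h2 \<circ> h1"
  have h: "h \<in> W" unfolding h_def using 1(1) 2(1) weyl_comp weyl_inv by blast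
  have "g2 (h v) = h (g1 v)" for v
    unfolding h_def using e[of "h1 v"] 1(1) 2(1) weyl_inv_left[OF 2(1)]
    by (metis comp_apply weyl_inv_left)
  then have "g2 v = (h \<circ> g1 \<circ> inv h) v" for v
    using weyl_inv_right[OF h, of v] by (metis comp_apply)
  then have "g2 = h \<circ> g1 \<circ> inv h" by (rule ext)
  then show ?thesis using h by (rule bexI[where x = h])
qed

text \<open>The case x = 1, \<eta> = 0: a conjugate of \<open>g\<close> followed by a coroot
  translation fixes a point of C. It later separates the characters obtained from \<open>u\<close>
  by W.\<close>

lemma regular_stabilizer_trivial:
  assumes g: "g \<in> W" and u: "u \<in> torus R" "regular R u" and fixed: "\<And>l. l \<in> wlat R \<Longrightarrow> u (inv g l) = u l"
  shows "g = id"
proof -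
  have "twisted_fix R g (\<lambda>_. 1) u" using fixed by (simp add: twisted_fix_def)
  moreover have "1 = torus_char 0 0 l" for l :: "real^'n" using torus_char_eq_1[of 0 0 l] by simp
  ultimately obtain h p q where h: "h \<in> W" "p \<in> C" "q \<in> corootlat R" "(h \<circ> g \<circ> inv h) p = p + 0 + q"
    using twisted_fix_conj_alcove[OF g u _ cowlat_zero] by metis
  have "h \<circ> g \<circ> inv h = id"
  proof (rule affine_weyl_free(1)[where q = "- q" and p = p])
    show "h \<circ> g \<circ> inv h \<in> W" using h(1) g weyl_comp weyl_inv by blast
    show "- q + (h \<circ> g \<circ> inv h) p \<in> C" unfolding h(4) using h(2) by simp
  qed (use h corootlat_minus in auto)
  then have "h (g v) = h v" for v
    using weyl_inv_left[OF h(1), of v] by (metis comp_apply id_apply)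
  then have "g v = v" for v using weyl_inv_left[OF h(1)] by metis
  then show ?thesis by auto
qed

section \<open>Existence of regular solutions\<close>

lemma center_pt_rational:
  assumes "l \<in> wlat R"
  shows "l \<bullet> center_pt \<in> \<rat>"
proof -
  have "rho \<in> cowlat R" by (simp add: cowlat_iff inner_rho ht_simple)
  then have "ht l \<in> \<rat>" using inner_wlat_cowlat_rat[OF assms] by (simp flip: inner_rho)
  moreover have "ht \<theta> + 1 \<in> \<rat>" using ht_int[OF highest_root(1)] Ints_subset_Rats by auto
  ultimately show ?thesis unfolding inner_center_pt by (rule Rats_divide)
qed

text \<open>If v |-> nu + w v fixes p in C then w multiplies the inverse of the torus element
  exp(p) by exp(nu).\<close>

lemma psi_twisted_fix:
  fixes E :: "real \<Rightarrow> complex"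
  assumes E_add: "\<And>s t. s \<in> \<rat> \<Longrightarrow> t \<in> \<rat> \<Longrightarrow> E (s + t) = E s * E t"
    and E_one: "\<And>s. s \<in> \<rat> \<Longrightarrow> E s = 1 \<longleftrightarrow> s \<in> \<int>"
    and mu: "mu \<in> cowlat R" and x: "\<And>l. l \<in> wlat R \<Longrightarrow> x l = E (l \<bullet> mu)"
  shows "psi R D mu \<in> W \<and> (\<exists>u\<in>torus R. regular R u \<and> twisted_fix R (psi R D mu) x u)"
proof -
  obtain w \<nu> where w: "w \<in> W" "\<nu> \<in> cowlat R" "\<nu> - mu \<in> corootlat R" "\<nu> + w center_pt \<in> C"
    using extended_exists[OF mu] by blast
  have psi: "psi R D mu = w" by (rule psi_eq[OF mu w(1-3) center_pt_alcove w(4)])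
  have fixed: "\<nu> + w center_pt = center_pt"
    by (rule extended_fixes_center_pt[OF w(1,2) center_pt_alcove w(4)])
  \<comment> \<open>\<open>E\<close> is controlled only on rationals;
    \<open>center_pt_rational\<close> guarantees that it is applied to nothing else on
    weights.\<close>
  define u where "u l = E (- (l \<bullet> center_pt))" for l
  have E0: "E s \<noteq> 0" if "s \<in> \<rat>" for s
  proof -
    have "E s * E (- s) = 1" using E_add[OF that, of "- s"] E_one[of 0] that by simp
    then show ?thesis by auto
  qed
  have "u \<in> torus R"
    unfolding torus_def mem_Collect_eq
  proof (intro conjI ballI)
    fix l m assume l: "l \<in> wlat R"
    then show "u l \<noteq> 0" using E0 center_pt_rational by (simp add: u_def)
    assume "m \<in> wlat R"
    then show "u (l + m) = u l * u m"
      using l E_add[of "- (l \<bullet> center_pt)" "- (m \<bullet> center_pt)"] center_pt_rational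
      by (simp add: u_def inner_add_left)
  qed
  moreover have "regular R u"
    unfolding regular_def
  proof
    fix a assume a: "a \<in> R"
    then have "- (a \<bullet> center_pt) \<notin> \<int>"
      using alcove_regular[OF center_pt_alcove] by (simp add: regular_point_def)
    then show "u a \<noteq> 1" using E_one center_pt_rational[OF wlat_root[OF a]] by (simp add: u_def)
  qed
  moreover have "twisted_fix R w x u"
    unfolding twisted_fix_def
  proof
    fix l assume l: "l \<in> wlat R"
    have Q: "l \<bullet> center_pt \<in> \<rat>" "l \<bullet> \<nu> \<in> \<rat>" "l \<bullet> mu \<in> \<rat>" "l \<bullet> (\<nu> - mu) \<in> \<int>"
      using l mu w center_pt_rational inner_wlat_cowlat_rat corootlat_wlat_int by blast+
    have "E (l \<bullet> \<nu>) = E (l \<bullet> mu + l \<bullet> (\<nu> - mu))" by (simp add: inner_diff_right)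
    also have "\<dots> = E (l \<bullet> mu) * E (l \<bullet> (\<nu> - mu))"
      using Q Ints_subset_Rats by (intro E_add) blast+
    also have "E (l \<bullet> (\<nu> - mu)) = 1" using Q(4) E_one Ints_subset_Rats by blast
    finally have nu: "E (l \<bullet> \<nu>) = x l" by (simp add: x[OF l])
    have "l \<bullet> center_pt = l \<bullet> \<nu> + l \<bullet> w center_pt" by (metis fixed inner_add_right)
    then have "- (inv w l \<bullet> center_pt) = l \<bullet> \<nu> + - (l \<bullet> center_pt)"
      by (simp add: weyl_inner_inv[OF w(1)])
    then have "u (inv w l) = E (l \<bullet> \<nu>) * E (- (l \<bullet> center_pt))"
      using E_add[of "l \<bullet> \<nu>" "- (l \<bullet> center_pt)"] Q by (simp add: u_def)
    then show "u (inv w l) = x l * u l" by (simp add: nu u_def)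
  qed
  ultimately show ?thesis using w(1) psi by blast
qed

text \<open>With E(s) = exp(2 pi i s) the coweight supplied by \<open>center_lift\<close> can be
  used directly.\<close>

lemma center_twisted_fix:
  assumes x: "x \<in> center R"
  shows "\<exists>g\<in>W. \<exists>u\<in>torus R. regular R u \<and> twisted_fix R g x u"
proof -
  obtain \<eta> where \<eta>: "\<eta> \<in> cowlat R" "\<And>l. l \<in> wlat R \<Longrightarrow> x l = torus_char 0 \<eta> l"
    using center_lift[OF x] by blast
  define E where "E s = exp (Complex 0 (2 * pi * s))" for s
  have "psi R D \<eta> \<in> W \<and> (\<exists>u\<in>torus R. regular R u \<and> twisted_fix R (psi R D \<eta>) x u)"
  proof (rule psi_twisted_fix[where E = E])
    show "E (s + t) = E s * E t" for s t
      by (simp add: E_def complex_add algebra_simps flip: exp_add)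
    show "E s = 1 \<longleftrightarrow> s \<in> \<int>" for s
      by (auto simp: E_def exp_eq_1 elim!: Ints_cases)
    show "x l = E (l \<bullet> \<eta>)" if "l \<in> wlat R" for l
      by (simp add: \<eta>(2)[OF that] torus_char_def E_def)
  qed (rule \<eta>(1))
  then show ?thesis by blast
qed

text \<open>The description operator inverts the inclusion of the rationals into the reals; on
  rational arguments, \<open>iota\<close> after it is a homomorphism whose kernel is the
  integers.\<close>

lemma xmu_twisted_fix:
  assumes iota: "QZ_embedding iota" and mu: "mu \<in> cowlat R" and x: "torus_eq R (xmu iota mu) x"
  shows "psi R D mu \<in> W \<and> (\<exists>u\<in>torus R. regular R u \<and> twisted_fix R (psi R D mu) x u)"
proof (rule psi_twisted_fix[where E = "\<lambda>s. iota (THE q. real_of_rat q = s)"])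
  fix s :: real assume "s \<in> \<rat>"
  then obtain p where p: "s = of_rat p" by (elim Rats_cases)
  have "p \<in> \<int> \<longleftrightarrow> s \<in> \<int>"
    unfolding p by (metis Ints_cases Ints_of_int of_rat_eq_iff of_rat_of_int_eq)
  then show "iota (THE q. real_of_rat q = s) = 1 \<longleftrightarrow> s \<in> \<int>"
    using iota by (simp add: QZ_embedding_def p)
  fix t :: real assume "t \<in> \<rat>"
  then obtain q where q: "t = of_rat q" by (elim Rats_cases)
  have "(THE r. real_of_rat r = s + t) = p + q"
    unfolding p q by (metis (mono_tags, lifting) of_rat_add of_rat_eq_iff the_equality)
  then show "iota (THE q. real_of_rat q = s + t) = iota (THE q. real_of_rat q = s) * iota (THE q. real_of_rat q = t)"
    using iota by (simp add: QZ_embedding_def p q)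
next
  show "x l = iota (THE q. real_of_rat q = l \<bullet> mu)" if "l \<in> wlat R" for l
    using x that by (simp add: torus_eq_def xmu_def)
qed (rule mu)

end

subsection \<open>Eigenvalues\<close>

text \<open>If T_m denotes translation by m, then (T_m - phi_j m)^2 kills the j-th term and multiplies
  the linear coefficient of the i-th one by (phi_i m - phi_j m)^2.\<close>

lemma exp_poly_independent:
  fixes \<phi> L :: "'i \<Rightarrow> 'a::ab_group_add \<Rightarrow> 'b::field" and c :: "'i \<Rightarrow> 'b"
  assumes "finite T" and P: "0 \<in> P" "\<And>x y. x \<in> P \<Longrightarrow> y \<in> P \<Longrightarrow> x + y \<in> P"
    and mult: "\<And>i x y. i \<in> T \<Longrightarrow> x \<in> P \<Longrightarrow> y \<in> P \<Longrightarrow> \<phi> i (x + y) = \<phi> i x * \<phi> i y"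
    and nz: "\<And>i x. i \<in> T \<Longrightarrow> x \<in> P \<Longrightarrow> \<phi> i x \<noteq> 0"
    and distinct: "\<And>i j. i \<in> T \<Longrightarrow> j \<in> T \<Longrightarrow> i \<noteq> j \<Longrightarrow> \<exists>x\<in>P. \<phi> i x \<noteq> \<phi> j x"
    and add: "\<And>i x y. i \<in> T \<Longrightarrow> x \<in> P \<Longrightarrow> y \<in> P \<Longrightarrow> L i (x + y) = L i x + L i y"
    and zero: "\<And>x. x \<in> P \<Longrightarrow> (\<Sum>i\<in>T. \<phi> i x * (L i x + c i)) = 0"
    and i: "i \<in> T" and x: "x \<in> P"
  shows "L i x = 0"
  using assms(1) mult nz distinct add zero i
proof (induction "card T" arbitrary: T L c rule: less_induct)
  case less
  show ?case
  proof (cases "\<exists>j\<in>T. j \<noteq> i")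
    case False
    then have T: "T = {i}" using less.prems(7) by blast
    have eq: "L i y + c i = 0" if "y \<in> P" for y
      using less.prems(6)[OF that] less.prems(3)[of i y] that T by simp
    moreover have "L i 0 = L i 0 + L i 0" using less.prems(5)[of i 0 0] P T by simp
    then have "L i 0 = 0" by (metis add_cancel_right_right)
    ultimately show ?thesis using eq[of 0] eq[OF x] P by simp
  next
    case True
    then obtain j where j: "j \<in> T" "j \<noteq> i" by blast
    then obtain m where m: "m \<in> P" "\<phi> i m \<noteq> \<phi> j m" using less.prems(4,7) by metis
    let ?a = "\<phi> j m"
    let ?L = "\<lambda>k y. (\<phi> k m - ?a)\<^sup>2 * L k y"
    \<comment> \<open>The last term stems from \<open>L k (y + m) = L k y + L k m\<close>. Constants
      thus appear in the induction even when it starts from c = 0. A single factor T_m - \<phi>_j m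
      would still leave a constant multiple of \<phi>_j, hence the square.\<close>
    let ?c = "\<lambda>k. (\<phi> k m - ?a)\<^sup>2 * c k + 2 * \<phi> k m * (\<phi> k m - ?a) * L k m"
    define f where "f k y = \<phi> k y * (L k y + c k)" for k y
    have diff: "f k (y + m + m) - 2 * ?a * f k (y + m) + ?a\<^sup>2 * f k y = \<phi> k y * (?L k y + ?c k)"
      if k: "k \<in> T" and y: "y \<in> P" for k y
    proof -
      have ym: "y + m \<in> P" using P y m by blast
      have 1: "\<phi> k (y + m) = \<phi> k y * \<phi> k m" "L k (y + m) = L k y + L k m"
        using less.prems(2,5) k y m by blast+
      have 2: "\<phi> k (y + m + m) = \<phi> k y * \<phi> k m * \<phi> k m" "L k (y + m + m) = L k y + L k m + L k m"
        using less.prems(2,5)[OF k ym m(1)] 1 by simp_all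
      show ?thesis unfolding f_def 1 2 by (simp add: power2_eq_square algebra_simps)
    qed
    have sum0: "(\<Sum>k\<in>T. f k y) = 0" if "y \<in> P" for y
      using less.prems(6)[OF that] by (simp add: f_def)
    have "?L i x = 0"
    proof (rule less.hyps[of "T - {j}" ?L ?c])
      show "card (T - {j}) < card T" using less.prems(1) j by (meson card_Diff1_less)
      fix y assume y: "y \<in> P"
      then have ym: "y + m \<in> P" "y + m + m \<in> P" using P m by blast+
      have "(\<Sum>k\<in>T. \<phi> k y * (?L k y + ?c k)) =
          (\<Sum>k\<in>T. f k (y + m + m) - 2 * ?a * f k (y + m) + ?a\<^sup>2 * f k y)"
        by (rule sum.cong[OF refl]) (rule diff[symmetric, OF _ y])
      also have "\<dots> = (\<Sum>k\<in>T. f k (y + m + m)) - 2 * ?a * (\<Sum>k\<in>T. f k (y + m)) + ?a\<^sup>2 * (\<Sum>k\<in>T. f k y)"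
        by (simp only: sum.distrib sum_subtractf sum_distrib_left)
      also have "\<dots> = 0" using sum0[OF y] sum0[OF ym(1)] sum0[OF ym(2)] by simp
      finally show "(\<Sum>k\<in>T - {j}. \<phi> k y * (?L k y + ?c k)) = 0"
        using sum.remove[OF less.prems(1) j(1), of "\<lambda>k. \<phi> k y * (?L k y + ?c k)"] by simp
    next
      fix k y z assume "k \<in> T - {j}" "y \<in> P" "z \<in> P"
      then show "?L k (y + z) = ?L k y + ?L k z"
        using less.prems(5)[of k y z] by (simp add: algebra_simps)
    qed (use less.prems j in auto)
    then show ?thesis using m(2) by simp
  qed
qed

section \<open>Characteristic polynomials from eigenbases\<close>

lemma sum_const_poly: "(\<Sum>k\<in>S. [:f k:]) = [:\<Sum>k\<in>S. f k:]"
  by (induction S rule: infinite_finite_induct) auto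

text \<open>Over the polynomial ring, (X - g) M = M E with E diagonal. Since M stays invertible
  there, its determinant can be cancelled, and multiplicities come out automatically.\<close>

lemma charpoly_eigenbasis:
  fixes g :: "real^'n \<Rightarrow> real^'n" and M :: "complex^'n^'n"
  assumes M: "invertible M"
    and eig: "\<And>i j. (\<Sum>k\<in>UNIV. complex_of_real (matrix g $ i $ k) * M $ k $ j) = e j * M $ i $ j"
  shows "charpoly g = (\<Prod>j\<in>UNIV. [:- e j, 1:])"
proof -
  define A where "A = (\<chi> i j. (if i = j then [:0, 1:] else 0) - [:complex_of_real (matrix g $ i $ j):])"
  define E where "E = (\<chi> i j. if i = j then [:- e j, 1:] else (0 :: complex poly))"
  define c :: "complex^'n^'n \<Rightarrow> complex poly^'n^'n" where "c N = (\<chi> i j. [:N $ i $ j:])" for N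
  obtain N where "M ** N = mat 1" using M by (auto simp: invertible_def)
  then have MN: "(\<Sum>k\<in>UNIV. M $ i $ k * N $ k $ j) = (if i = j then 1 else 0)" for i j
    by (simp add: matrix_matrix_mult_def mat_def vec_eq_iff)
  have "c M ** c N = mat 1"
    using MN by (simp add: matrix_matrix_mult_def mat_def vec_eq_iff c_def sum_const_poly one_pCons mult.commute)
  then have "det (c M) * det (c N) = 1" by (metis det_mul det_I)
  then have nz: "det (c M) \<noteq> 0" by auto
  have "A ** c M = c M ** E"
  proof -
    have "(\<Sum>k\<in>UNIV. A $ i $ k * c M $ k $ j) = (\<Sum>k\<in>UNIV. c M $ i $ k * E $ k $ j)" for i j
    proof -
      have "(\<Sum>k\<in>UNIV. A $ i $ k * c M $ k $ j) =
          (\<Sum>k\<in>UNIV. (if i = k then [:0, M $ k $ j:] else 0) - [:complex_of_real (matrix g $ i $ k) * M $ k $ j:])"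
        by (rule sum.cong) (auto simp: A_def c_def algebra_simps)
      also have "\<dots> = [:0, M $ i $ j:] - [:e j * M $ i $ j:]"
        by (simp add: sum_subtractf sum_const_poly eig)
      also have "\<dots> = (\<Sum>k\<in>UNIV. if k = j then [:M $ i $ k:] * [:- e j, 1:] else 0)"
        by (simp add: mult.commute)
      also have "\<dots> = (\<Sum>k\<in>UNIV. c M $ i $ k * E $ k $ j)"
        by (rule sum.cong) (auto simp: E_def c_def)
      finally show ?thesis .
    qed
    then show ?thesis by (simp add: matrix_matrix_mult_def vec_eq_iff)
  qed
  then have "det A * det (c M) = det (c M) * det E" by (metis det_mul)
  then have "det A = det E" using nz by (simp add: mult.commute)
  also have "\<dots> = (\<Prod>j\<in>UNIV. E $ j $ j)" by (rule det_diagonal) (simp add: E_def)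
  finally show ?thesis by (simp add: charpoly_def A_def E_def)
qed

lemma det_nonzero_if_no_left_kernel:
  fixes M :: "complex^'n^'n"
  assumes "\<And>y. (\<And>j. (\<Sum>i\<in>UNIV. M $ i $ j * y $ i) = 0) \<Longrightarrow> y = 0"
  shows "invertible M"
proof -
  have "y = 0" if "transpose M *v y = 0" for y
  proof (rule assms)
    fix j
    have "(transpose M *v y) $ j = 0" using that by simp
    then show "(\<Sum>i\<in>UNIV. M $ i $ j * y $ i) = 0"
      by (simp add: matrix_vector_mult_def transpose_def)
  qed
  then have "\<exists>B. B ** transpose M = mat 1" by (subst matrix_left_invertible_ker) blast
  then have "invertible (transpose M)" using matrix_left_right_inverse by (auto simp: invertible_def)
  then show ?thesis by (simp add: invertible_det_nz det_transpose)
qed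

context based_root_system
begin

section \<open>Dominant weights and their heights\<close>

definition dominant :: "real^'n \<Rightarrow> bool" where
  "dominant l \<longleftrightarrow> (\<forall>a\<in>D. l \<bullet> coroot a \<ge> 0)"

lemma dominant_fund_weight: "a \<in> D \<Longrightarrow> dominant (\<omega> a)"
  by (simp add: dominant_def fund_weight_coroot)

text \<open>Reflecting a point of the W-orbit of the point of C towards C increases its inner
  product with a dominant l, unless the reflection fixes l.\<close>

lemma dominant_orbit_inner:
  assumes l: "dominant l" and w: "w \<in> W"
  shows "l \<bullet> w center_pt \<le> l \<bullet> center_pt \<and> (l \<bullet> w center_pt = l \<bullet> center_pt \<longrightarrow> w l = l)"
  using w
proof (induction "card (separating center_pt (w center_pt))" arbitrary: w rule: less_induct)
  case less
  let ?c = "w center_pt"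
  show ?case
  proof (cases "?c \<in> C")
    case True
    then have "w = id"
      using affine_weyl_free(1)[OF less(2) corootlat_zero center_pt_alcove] by simp
    then show ?thesis by simp
  next
    case False
    \<comment> \<open>The images of \<open>center_pt\<close> under W never violate the wall of
      \<theta>, so the violated wall is a simple one and its reflection stays in W.\<close>
    have "\<theta> \<bullet> ?c = inv w \<theta> \<bullet> center_pt" using weyl_inner_inv[OF less(2)] by simp
    moreover have "(- inv w \<theta>, 1) \<in> aroots"
      using weyl_root[OF weyl_inv[OF less(2)] highest_root(1)] by (simp add: aroots_iff)
    then have "ev (- inv w \<theta>, 1) center_pt > 0"
      using apos_ev_pos[OF _ apos_if_level_pos center_pt_alcove] by simp
    ultimately have "\<theta> \<bullet> ?c < 1" by (simp add: ev_def)
    then obtain a where a: "a \<in> D" "a \<bullet> ?c \<le> 0" using False by (auto simp: alcove_def not_less)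
    have "regular_point ?c"
      using alcove_regular[OF center_pt_alcove] weyl_root[OF weyl_inv[OF less(2)]] weyl_inner_inv[OF less(2)]
      by (metis regular_point_def)
    then have "a \<bullet> ?c \<noteq> 0" using D_root[OF a(1)] by (auto simp: regular_point_def)
    then have neg: "a \<bullet> ?c < 0" using a by simp
    let ?w = "refl a \<circ> w"
    have w': "?w \<in> W" using less(2) D_root[OF a(1)] weyl_group.weyl_refl by blast
    have "card (separating center_pt (?w center_pt)) < card (separating center_pt ?c)"
      using card_separating_less[OF center_pt_alcove simple_wall[OF a(1)], of ?c] neg
      by (simp add: affine_refl_zero ev_def)
    from less(1)[OF this w'] have IH: "l \<bullet> ?w center_pt \<le> l \<bullet> center_pt"
      "l \<bullet> ?w center_pt = l \<bullet> center_pt \<Longrightarrow> ?w l = l" by blast+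
    have eq: "l \<bullet> ?w center_pt = l \<bullet> ?c - (a \<bullet> ?c) * (l \<bullet> coroot a)"
      by (simp add: refl_coroot_form inner_diff_right)
    have la: "l \<bullet> coroot a \<ge> 0" using l a by (simp add: dominant_def)
    then have nn: "(a \<bullet> ?c) * (l \<bullet> coroot a) \<le> 0" using neg by (simp add: mult_nonpos_nonneg)
    show ?thesis
    proof (intro conjI impI)
      show "l \<bullet> ?c \<le> l \<bullet> center_pt" using IH(1) eq nn by linarith
      assume e: "l \<bullet> ?c = l \<bullet> center_pt"
      then have "(a \<bullet> ?c) * (l \<bullet> coroot a) = 0" using IH(1) eq nn by linarith
      then have "refl a l = l" using neg by (simp add: refl_def)
      moreover have "refl a (w l) = l" using IH(2) eq e \<open>(a \<bullet> ?c) * (l \<bullet> coroot a) = 0\<close> by simp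
      ultimately show "w l = l" by (metis refl_refl)
    qed
  qed
qed

text \<open>Up to the factor h, height is the pairing with \<open>center_pt\<close>, so
  \<open>dominant_orbit_inner\<close> applies to \<open>inv w\<close>.\<close>

lemma ht_weyl_le:
  assumes l: "dominant l" and w: "w \<in> W"
  shows "ht (w l) \<le> ht l" and "ht (w l) = ht l \<Longrightarrow> w l = l"
proof -
  have H: "ht \<theta> + 1 > 0" using ht_highest_pos by simp
  have "w l \<bullet> center_pt = l \<bullet> inv w center_pt"
    using weyl_inner_inv[OF w, of center_pt l] by (simp add: inner_commute)
  then have e: "ht (w l) / (ht \<theta> + 1) = l \<bullet> inv w center_pt" by (simp add: inner_center_pt)
  have d: "l \<bullet> inv w center_pt \<le> l \<bullet> center_pt"
    "l \<bullet> inv w center_pt = l \<bullet> center_pt \<Longrightarrow> inv w l = l"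
    using dominant_orbit_inner[OF l weyl_inv[OF w]] by blast+
  show "ht (w l) \<le> ht l" using d(1) H unfolding e[symmetric] inner_center_pt
    by (simp add: divide_le_cancel)
  assume "ht (w l) = ht l"
  then have "inv w l = l" using d(2) by (simp add: inner_center_pt flip: e)
  then show "w l = l" by (metis weyl_inv_right[OF w])
qed

text \<open>Choose an orbit point of maximal height: a negative pairing with a simple coroot would
  let the simple reflection raise it.\<close>

lemma dominant_representative:
  obtains w where "w \<in> W" "dominant (w l)"
proof -
  obtain w where w: "w \<in> W" "\<And>v. v \<in> W \<Longrightarrow> ht (v l) \<le> ht (w l)"
    using finite_maximizer[OF finite_W, of "\<lambda>w. ht (w l)"] id_W by blast
  have "dominant (w l)"
    unfolding dominant_def
  proof
    fix a assume a: "a \<in> D"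
    have "ht (refl a (w l)) \<le> ht (w l)"
      using w(2)[OF weyl_group.weyl_refl[OF D_root[OF a] w(1)]] by simp
    then show "w l \<bullet> coroot a \<ge> 0" by (simp add: ht_refl_simple[OF a])
  qed
  then show ?thesis using that w(1) by blast
qed

lemma sum_ht_weyl: "(\<Sum>w\<in>W. ht (w l)) = 0"
proof -
  have "(\<Sum>w\<in>W. ht (w l)) = (\<Sum>w\<in>W. w l \<bullet> rho)" by (simp only: inner_rho)
  also have "\<dots> = (\<Sum>w\<in>W. w l) \<bullet> rho" by (rule inner_sum_left[symmetric])
  finally show ?thesis by (simp add: sum_weyl_zero)
qed

text \<open>Heights average to zero over W, and a dominant \<open>l\<close> has the largest one in
  its orbit.\<close>

lemma ht_dominant_nonneg:
  assumes "dominant l"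
  shows "ht l \<ge> 0"
proof -
  have "0 \<le> (\<Sum>w\<in>W. ht l)"
    using sum_mono[of W "\<lambda>w. ht (w l)" "\<lambda>w. ht l"] ht_weyl_le(1)[OF assms] sum_ht_weyl[of l] by simp
  then show ?thesis using card_W_pos by (auto simp: zero_le_mult_iff)
qed

text \<open>If this maximal height were zero, the zero average would make all orbit heights zero,
  and \<open>refl a\<close> would fix \<open>\<omega> a\<close>, although it subtracts
  \<open>a\<close>.\<close>

lemma ht_fund_weight_pos:
  assumes a: "a \<in> D"
  shows "ht (\<omega> a) > 0"
proof (rule ccontr)
  assume "\<not> ?thesis"
  then have z: "ht (\<omega> a) = 0" using ht_dominant_nonneg[OF dominant_fund_weight[OF a]] by simp
  have ra: "refl a \<in> W" using refl_in_weyl D_root a by blast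
  have "\<forall>w\<in>W. - ht (w (\<omega> a)) = 0"
    using ht_weyl_le(1)[OF dominant_fund_weight[OF a]] sum_ht_weyl[of "\<omega> a"] z
    by (subst sum_nonneg_eq_0_iff[symmetric]) (auto simp: sum_negf)
  then have "refl a (\<omega> a) = \<omega> a"
    using ht_weyl_le(2)[OF dominant_fund_weight[OF a] ra] z ra by simp
  then show False using a root_nonzero[OF D_root[OF a]] by (simp add: refl_def fund_weight_coroot)
qed

text \<open>Heights of weights can be fractional; this common denominator turns them into an
  induction measure.\<close>

lemma card_W_ht_int: "l \<in> wlat R \<Longrightarrow> real (card W) * ht l \<in> \<int>"
  using card_weyl_inner_int[of l rho] by (simp add: cowlat_iff inner_rho ht_simple)

text \<open>The sum Phi l is the derivative along L, at u, of the W-invariant sum S l. The product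
  rule shows that if these derivatives vanish for the fundamental weights, they all vanish.\<close>

lemma orbit_sum_derivative_zero:
  fixes L :: "real^'n \<Rightarrow> complex"
  assumes u: "u \<in> torus R" and L: "\<And>x y. L (x + y) = L x + L y"
    and fund: "\<And>a. a \<in> D \<Longrightarrow> (\<Sum>w\<in>W. u (w (\<omega> a)) * L (w (\<omega> a))) = 0"
    and l: "l \<in> wlat R"
  shows "(\<Sum>w\<in>W. u (w l) * L (w l)) = 0"
proof -
  define \<Phi> where "\<Phi> l = (\<Sum>w\<in>W. u (w l) * L (w l))" for l
  define S where "S l = (\<Sum>w\<in>W. u (w l))" for l
  have inv: "\<Phi> (v l) = \<Phi> l" if "v \<in> W" for v l
    using sum.reindex_bij_betw[OF bij_betw_weyl_right[OF that], of "\<lambda>w. u (w l) * L (w l)"]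
    by (simp add: \<Phi>_def)
  \<comment> \<open>The Leibniz rule for S l * S m, which equals the sum of S (l + v m) over v in
    W.\<close>
  have product: "(\<Sum>v\<in>W. \<Phi> (l + v m)) = \<Phi> l * S m + S l * \<Phi> m" if l: "l \<in> wlat R" and m: "m \<in> wlat R" for l m
  proof -
    have "(\<Sum>v\<in>W. \<Phi> (l + v m)) = (\<Sum>w\<in>W. \<Sum>v\<in>W. u (w (l + v m)) * L (w (l + v m)))"
      unfolding \<Phi>_def by (rule sum.swap)
    also have "\<dots> = (\<Sum>w\<in>W. \<Sum>v\<in>W. u (w l) * u ((w \<circ> v) m) * (L (w l) + L ((w \<circ> v) m)))"
    proof (intro sum.cong refl)
      fix w v assume wv: "w \<in> W" "v \<in> W"
      have "u (w l + w (v m)) = u (w l) * u (w (v m))"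
        using torus_add[OF u] wlat_weyl wv l m by blast
      then show "u (w (l + v m)) * L (w (l + v m)) = u (w l) * u ((w \<circ> v) m) * (L (w l) + L ((w \<circ> v) m))"
        using wv by (simp add: weyl_add L)
    qed
    also have "\<dots> = (\<Sum>w\<in>W. \<Sum>v\<in>W. u (w l) * u (v m) * (L (w l) + L (v m)))"
    proof (rule sum.cong[OF refl])
      fix w assume w: "w \<in> W"
      show "(\<Sum>v\<in>W. u (w l) * u ((w \<circ> v) m) * (L (w l) + L ((w \<circ> v) m))) =
          (\<Sum>v\<in>W. u (w l) * u (v m) * (L (w l) + L (v m)))"
        by (rule sum.reindex_bij_betw[OF bij_betw_weyl_left[OF w], of "\<lambda>v. u (w l) * u (v m) * (L (w l) + L (v m))"])
    qed
    also have "\<dots> = \<Phi> l * S m + S l * \<Phi> m"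
      unfolding \<Phi>_def S_def sum_product by (simp add: sum.distrib[symmetric] algebra_simps)
    finally show ?thesis .
  qed
  define N where "N l = nat \<lfloor>real (card W) * ht l\<rfloor>" for l
  have N_less: "N l < N m" if l: "l \<in> wlat R" "dominant l" and m: "m \<in> wlat R" and less: "ht l < ht m" for l m
  proof -
    have "real (card W) * ht l < real (card W) * ht m" using less card_W_pos by simp
    moreover obtain i j where ij: "real (card W) * ht l = of_int i" "real (card W) * ht m = of_int j"
      using card_W_ht_int[OF l(1)] card_W_ht_int[OF m] by (elim Ints_cases)
    moreover have "real (card W) * ht l \<ge> 0" using ht_dominant_nonneg[OF l(2)] by simp
    ultimately show ?thesis unfolding N_def ij by simp
  qed
  have "L 0 = L 0 + L 0" using L[of 0 0] by simp
  then have L0: "L 0 = 0" by (metis add_cancel_right_right)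
  have dom: "\<Phi> l = 0" if "l \<in> wlat R" "dominant l" for l
    using that
  proof (induction "N l" arbitrary: l rule: less_induct)
    case less
    show ?case
    proof (cases "l = 0")
      case True
      then show ?thesis by (simp add: \<Phi>_def weyl_zero L0)
    next
      case False
      then obtain a where a: "a \<in> D" "l \<bullet> coroot a \<noteq> 0"
        using eq_if_inner_coroot_eq[of l 0] by auto
      then have "l \<bullet> coroot a \<ge> 1"
        using less(3) Ints_pos_ge_one[OF wlat_int[OF less(2) D_root[OF a(1)]]]
        by (force simp: dominant_def less_le)
      define m where "m = l - \<omega> a"
      have m: "m \<in> wlat R" using wlat_diff[OF less(2) fund_weight_wlat[OF a(1)]] by (simp add: m_def)
      have md: "dominant m"
        using less(3) \<open>l \<bullet> coroot a \<ge> 1\<close> a(1) by (auto simp: dominant_def m_def inner_diff_left fund_weight_coroot)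
      have l_eq: "l = m + \<omega> a" by (simp add: m_def)
      have ht_l: "ht l = ht m + ht (\<omega> a)" by (simp add: m_def ht_diff)
      have "N m < N l" using N_less[OF m md less(2)] ht_fund_weight_pos[OF a(1)] ht_l by simp
      then have "\<Phi> m = 0" using less(1) m md by blast
      moreover have "\<Phi> (\<omega> a) = 0" using fund[OF a(1)] by (simp add: \<Phi>_def)
      ultimately have sum0: "(\<Sum>v\<in>W. \<Phi> (m + v (\<omega> a))) = 0"
        using product[OF m fund_weight_wlat[OF a(1)]] by simp
      \<comment> \<open>The dominant weight in the orbit of \<open>m + v (\<omega> a)\<close> either
        has smaller height than \<open>l\<close> and falls to the induction, or attains the height
        of \<open>l\<close>; equality in \<open>ht_weyl_le\<close> for both summands then makes it
        \<open>l\<close>.\<close>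
      have cases: "\<Phi> (m + v (\<omega> a)) = 0 \<or> \<Phi> (m + v (\<omega> a)) = \<Phi> l" if v: "v \<in> W" for v
      proof -
        obtain y where y: "y \<in> W" "dominant (y (m + v (\<omega> a)))" using dominant_representative by blast
        let ?k = "y (m + v (\<omega> a))"
        have yv: "y \<circ> v \<in> W" using weyl_comp y v by blast
        have k: "?k \<in> wlat R" using wlat_weyl wlat_add m fund_weight_wlat[OF a(1)] y v by blast
        have k_eq: "?k = y m + (y \<circ> v) (\<omega> a)" using y by (simp add: weyl_add)
        have ht_k: "ht ?k = ht (y m) + ht ((y \<circ> v) (\<omega> a))"
          unfolding k_eq by (simp add: ht_def inner_add_left sum.distrib)
        note le = ht_weyl_le[OF md y(1)] ht_weyl_le[OF dominant_fund_weight[OF a(1)] yv]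
        show ?thesis
        proof (cases "ht ?k < ht l")
          case True
          then have "\<Phi> ?k = 0" using less(1) N_less[OF k y(2) less(2)] k y(2) by blast
          then show ?thesis using inv[OF y(1)] by simp
        next
          case False
          then have "ht (y m) = ht m" "ht ((y \<circ> v) (\<omega> a)) = ht (\<omega> a)"
            using le(1,3) ht_k ht_l by linarith+
          then have "?k = l" using le(2,4) unfolding k_eq l_eq by simp
          then show ?thesis using inv[OF y(1), of "m + v (\<omega> a)"] by simp
        qed
      qed
      \<comment> \<open>All summands being 0 or \<open>\<Phi> l\<close>, the vanishing sum is
        \<open>card A\<close> times \<open>\<Phi> l\<close>; the identity lies in \<open>A\<close>
        because \<open>l = m + \<omega> a\<close>.\<close>
      define A where "A = {v\<in>W. \<Phi> (m + v (\<omega> a)) = \<Phi> l}"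
      have "(\<Sum>v\<in>W. \<Phi> (m + v (\<omega> a))) = (\<Sum>v\<in>W. if \<Phi> (m + v (\<omega> a)) = \<Phi> l then \<Phi> l else 0)"
        by (rule sum.cong) (use cases in auto)
      also have "\<dots> = of_nat (card A) * \<Phi> l"
        by (simp add: A_def sum.If_cases Int_def)
      finally have A0: "of_nat (card A) * \<Phi> l = 0" using sum0 by simp
      have "id \<in> A" by (simp add: A_def l_eq[symmetric])
      moreover have "finite A" by (simp add: A_def)
      ultimately have "card A \<noteq> 0" by (metis card_eq_0_iff empty_iff)
      then show ?thesis using A0 by simp
    qed
  qed
  obtain w where "w \<in> W" "dominant (w l)" using dominant_representative by blast
  then have "\<Phi> l = 0" using dom[of "w l"] inv[of w l] wlat_weyl l by simp
  then show ?thesis by (simp add: \<Phi>_def)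
qed

text \<open>The vanishing derivatives form a relation, valid for every weight l, between the
  characters l -> u (w l) with additive coefficients l -> L (w l). The coefficient at w = id is L
  itself.\<close>

lemma orbit_sum_gradients_independent:
  fixes L :: "real^'n \<Rightarrow> complex"
  assumes u: "u \<in> torus R" "regular R u" and L: "\<And>x y. L (x + y) = L x + L y"
    and fund: "\<And>a. a \<in> D \<Longrightarrow> (\<Sum>w\<in>W. u (w (\<omega> a)) * L (w (\<omega> a))) = 0"
    and l: "l \<in> wlat R"
  shows "L l = 0"
proof -
  have "L (id l) = 0"
  proof (rule exp_poly_independent[where T = W and P = "wlat R" and \<phi> = "\<lambda>w x. u (w x)"
        and L = "\<lambda>w x. L (w x)" and c = "\<lambda>_. 0" and i = id])
    show "u (w (x + y)) = u (w x) * u (w y)" if "w \<in> W" "x \<in> wlat R" "y \<in> wlat R" for w x y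
      using that torus_add[OF u(1)] wlat_weyl by (simp add: weyl_add)
    show "u (w x) \<noteq> 0" if "w \<in> W" "x \<in> wlat R" for w x
      using that torus_nonzero[OF u(1)] wlat_weyl by blast
    show "L (w (x + y)) = L (w x) + L (w y)" if "w \<in> W" for w x y
      using that by (simp add: weyl_add L)
    show "(\<Sum>w\<in>W. u (w x) * (L (w x) + 0)) = 0" if "x \<in> wlat R" for x
      using orbit_sum_derivative_zero[OF u(1) L fund that] by simp
    show "\<exists>x\<in>wlat R. u (v x) \<noteq> u (w x)" if vw: "v \<in> W" "w \<in> W" "v \<noteq> w" for v w
    proof (rule ccontr)
      assume "\<not> ?thesis"
      then have same: "u (v x) = u (w x)" if "x \<in> wlat R" for x using that by blast
      have "w \<circ> inv v = id"
      proof (rule regular_stabilizer_trivial[OF _ u])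
        show "w \<circ> inv v \<in> W" using vw weyl_comp weyl_inv by blast
        fix x assume x: "x \<in> wlat R"
        have i: "inv (w \<circ> inv v) = v \<circ> inv w"
          using o_inv_distrib[OF weyl_bij weyl_bij] vw weyl_inv inv_inv_eq[OF weyl_bij] by metis
        show "u (inv (w \<circ> inv v) x) = u x"
          unfolding i using same[OF wlat_weyl[OF weyl_inv[OF vw(2)] x]] vw by simp
      qed
      then have "w (inv v (v x)) = v x" for x by (metis comp_apply id_apply)
      then show False using vw by (metis ext weyl_inv_left)
    qed
  qed (use l in \<open>auto simp: wlat_zero wlat_add\<close>)
  then show ?thesis by simp
qed

section \<open>The eigenbasis and the characteristic polynomial of g\<close>

lemma center_weyl:
  assumes x: "x \<in> center R" and w: "w \<in> W" and l: "l \<in> wlat R"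
  shows "x (w l) = x l"
proof -
  obtain \<eta> where \<eta>: "\<eta> \<in> cowlat R" "\<And>l. l \<in> wlat R \<Longrightarrow> x l = torus_char 0 \<eta> l"
    using center_lift[OF x] by blast
  have "torus_char 0 (inv w \<eta> - \<eta>) l = 1"
    using corootlat_wlat_int[OF weyl_diff_corootlat[OF weyl_inv[OF w] \<eta>(1)] l]
    by (simp add: torus_char_eq_1)
  moreover have "torus_char 0 (inv w \<eta> - \<eta>) l * torus_char 0 \<eta> l = torus_char 0 (inv w \<eta>) l"
    by (simp add: torus_char_mult)
  moreover have "torus_char 0 (inv w \<eta>) l = torus_char 0 \<eta> (w l)"
    using weyl_inner_inv[OF w, of \<eta> l] by (simp add: torus_char_def inner_commute)
  ultimately show ?thesis using \<eta>(2)[OF l] \<eta>(2)[OF wlat_weyl[OF w l]] by simp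
qed

lemma charpoly_twisted_fix:
  assumes x: "x \<in> center R" and g: "g \<in> W" and u: "u \<in> torus R" "regular R u" "twisted_fix R g x u"
  shows "charpoly g = (\<Prod>a\<in>D. [:- inverse (x (\<omega> a)), 1:])"
proof -
  \<comment> \<open>Passing to the inverse of \<open>u\<close> turns the multiplier x into its
    inverse, the eigenvalue sought.\<close>
  define v where "v l = inverse (u l)" for l
  have v: "v \<in> torus R" "regular R v"
    using u(1,2) by (auto simp: torus_def regular_def v_def inverse_eq_1_iff)
  have tw: "v (inv g l) = inverse (x l) * v l" if "l \<in> wlat R" for l
    using u(3) that by (simp add: twisted_fix_def v_def)
  have "card D = CARD('n)"
    using basis_card_eq_dim[of D UNIV] D_independent span_D by simp
  then obtain \<sigma> where \<sigma>: "bij_betw \<sigma> (UNIV :: 'n set) D"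
    using finite_same_card_bij[of "UNIV :: 'n set" D] by auto
  then have \<sigma>D: "\<sigma> j \<in> D" for j by (auto simp: bij_betw_def)
  define F where "F a i = (\<Sum>w\<in>W. v (w (\<omega> a)) * of_real (w (\<omega> a) $ i))" for a i
  define M where "M = (\<chi> i j. F (\<sigma> j) i)"
  have "charpoly g = (\<Prod>j\<in>UNIV. [:- inverse (x (\<omega> (\<sigma> j))), 1:])"
  proof (rule charpoly_eigenbasis[where M = M])
    fix i j
    define l where "l = \<omega> (\<sigma> j)"
    have l: "l \<in> wlat R" using fund_weight_wlat[OF \<sigma>D] by (simp add: l_def)
    have mat: "(\<Sum>k\<in>UNIV. complex_of_real (matrix g $ i $ k) * of_real (y $ k)) = of_real (g y $ i)" for y
    proof -
      have "g y $ i = (matrix g *v y) $ i" using fun_cong[OF matrix_vector_mul(2)[OF weyl_linear[OF g]], of y] by simp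
      then show ?thesis by (simp add: matrix_vector_mult_def)
    qed
    have "(\<Sum>k\<in>UNIV. complex_of_real (matrix g $ i $ k) * M $ k $ j) =
        (\<Sum>w\<in>W. v (w l) * (\<Sum>k\<in>UNIV. complex_of_real (matrix g $ i $ k) * of_real (w l $ k)))"
      by (simp add: M_def F_def l_def sum_distrib_left) (subst sum.swap, simp add: mult_ac)
    also have "\<dots> = (\<Sum>w\<in>W. v (inv g ((g \<circ> w) l)) * of_real ((g \<circ> w) l $ i))"
      by (rule sum.cong) (simp_all add: mat weyl_inv_left[OF g])
    \<comment> \<open>The map \<open>g\<close> has been moved onto the orbit; reindexing by w -> g w
      then leaves it only inside \<open>v\<close>, where \<open>tw\<close> turns it into a scalar
      that is constant on the orbit.\<close>
    also have "\<dots> = (\<Sum>w\<in>W. v (inv g (w l)) * of_real (w l $ i))"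
      by (rule sum.reindex_bij_betw[OF bij_betw_weyl_left[OF g], of "\<lambda>w. v (inv g (w l)) * of_real (w l $ i)"])
    also have "\<dots> = (\<Sum>w\<in>W. inverse (x l) * (v (w l) * of_real (w l $ i)))"
      by (rule sum.cong) (simp_all add: tw wlat_weyl l center_weyl[OF x])
    also have "\<dots> = inverse (x l) * M $ i $ j"
      by (simp add: M_def F_def l_def sum_distrib_left)
    finally show "(\<Sum>k\<in>UNIV. complex_of_real (matrix g $ i $ k) * M $ k $ j) = inverse (x (\<omega> (\<sigma> j))) * M $ i $ j"
      by (simp add: l_def)
  next
    show "invertible M"
    proof (rule det_nonzero_if_no_left_kernel)
      fix y :: "complex^'n" assume y: "\<And>j. (\<Sum>i\<in>UNIV. M $ i $ j * y $ i) = 0"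
      \<comment> \<open>A vector \<open>y\<close> in the left kernel of \<open>M\<close> is a linear
        form that annihilates every column. It then vanishes on all weights, hence on V, and the
        coordinate axes give \<open>y = 0\<close>.\<close>
      define L where "L z = (\<Sum>i\<in>UNIV. of_real (z $ i) * y $ i)" for z :: "real^'n"
      have L_add: "L (z + z') = L z + L z'" for z z'
        by (simp add: L_def sum.distrib algebra_simps)
      have L_scale: "L (c *\<^sub>R z) = of_real c * L z" for c z
        by (simp add: L_def sum_distrib_left algebra_simps)
      have "(\<Sum>w\<in>W. v (w (\<omega> a)) * L (w (\<omega> a))) = 0" if a: "a \<in> D" for a
      proof -
        obtain j where j: "a = \<sigma> j" using a bij_betw_imp_surj_on[OF \<sigma>] by blast
        have "(\<Sum>w\<in>W. v (w (\<omega> a)) * L (w (\<omega> a))) = (\<Sum>i\<in>UNIV. M $ i $ j * y $ i)"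
          unfolding L_def M_def F_def
          by (simp add: sum_distrib_left sum_distrib_right j) (subst sum.swap, simp add: mult_ac)
        then show ?thesis using y by simp
      qed
      then have L0: "L l = 0" if "l \<in> wlat R" for l
        using orbit_sum_gradients_independent[OF v L_add _ that] by blast
      have L_sum: "L (\<Sum>a\<in>S. f a *\<^sub>R \<omega> a) = (\<Sum>a\<in>S. of_real (f a) * L (\<omega> a))" if "finite S" for S f
        using that by (induction S rule: finite_induct) (simp_all add: L_add L_scale, simp add: L_def)
      have "L z = 0" for z
        using L_sum[OF finite_D, of "\<lambda>a. z \<bullet> coroot a"] L0 fund_weight_wlat
          fund_weight_expansion[of z] by simp
      then have "y $ i = 0" for i
        using \<open>\<And>z. L z = 0\<close>[of "axis i 1"]
        by (simp add: L_def axis_def if_distrib[of of_real] if_distrib[of "\<lambda>c. c * _"] cong: if_cong)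
      then show "y = 0" by (simp add: vec_eq_iff)
    qed
  qed
  also have "\<dots> = (\<Prod>a\<in>D. [:- inverse (x (\<omega> a)), 1:])"
    by (rule prod.reindex_bij_betw[OF \<sigma>])
  finally show ?thesis .
qed

end

theorem theorem4p4:
  fixes R D :: "(real^'n) set" and iota :: "rat \<Rightarrow> complex"
  assumes "root_system R" and "is_base R D" and "QZ_embedding iota"
  shows
   "(\<forall>x\<in>center R. \<exists>g\<in>weyl_group R. \<exists>u\<in>torus R. regular R u \<and> twisted_fix R g x u)
  \<and> (\<forall>x\<in>center R. \<forall>mu\<in>cowlat R. torus_eq R (xmu iota mu) x \<longrightarrow>
        psi R D mu \<in> weyl_group R \<and>
        (\<exists>u\<in>torus R. regular R u \<and> twisted_fix R (psi R D mu) x u))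
  \<and> (\<forall>x\<in>center R. \<forall>g1\<in>weyl_group R. \<forall>g2\<in>weyl_group R.
        (\<exists>u\<in>torus R. regular R u \<and> twisted_fix R g1 x u) \<longrightarrow>
        (\<exists>u\<in>torus R. regular R u \<and> twisted_fix R g2 x u) \<longrightarrow>
        (\<exists>h\<in>weyl_group R. g2 = h \<circ> g1 \<circ> inv h))
  \<and> (\<forall>x\<in>center R. \<forall>g\<in>weyl_group R.
        (\<exists>u\<in>torus R. regular R u \<and> twisted_fix R g x u) \<longrightarrow>
        charpoly g = (\<Prod>a\<in>D. [:- inverse (x (fund_weight D a)), 1:]))"
proof -
  interpret based_root_system R D
    by unfold_locales (use assms in auto)
  show ?thesis
    using center_twisted_fix xmu_twisted_fix[OF assms(3)] twisted_fix_conjugate charpoly_twisted_fix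
    by (intro conjI) blast+
qed

end
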